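(* Let $\mathbb A$ be one of the four complex composition algebras $\mathbb A_{\mathbb R}\otimes_{\mathbb R}\mathbb C$, $\mathbb A_{\mathbb R}=\mathbb R,\mathbb C,\mathbb H,\mathbb O$, and let $Q$ be the quartic form on $\mathcal Z_2(\mathbb A)=\mathbb C\oplus W\oplus W^*\oplus\mathbb C^*$, $W=\mathcal J_3(\mathbb A)$, defined for $w=(\alpha,r,s^*,\beta^* )$ by $$Q(w)=\Big(3\alpha\beta^*-\tfrac12\langle r,s^*\rangle\Big)^2+\tfrac13\big(\beta^*C(r^3)+\alpha C^*(s^{*3})\big)-\tfrac16\langle C^*(s^{*2}),C(r^2)\rangle .$$ Then $Q$ is the unique $Sp_6(\mathbb A)$-invariant polynomial on $\mathcal Z_2(\mathbb A)$ whose restriction to the four-dimensional subspace $$\Delta_{\mathcal Z}=\{(\alpha,\,xI,\,yI,\,\beta^* )\ :\ \alpha,x,y,\beta^*\in\mathbb C\}\subset\mathcal Z_2(\mathbb A)$$ is the classical discriminant of a binary cubic (after rescaling). That is: there are nonzero constants $\lambda,\mu,\kappa$ such that with $p_0=\alpha$, $p_1=\lambda x$, $p_2=\mu y$, $p_3=\beta^*$ one has $Q|_{\Delta_{\mathcal Z}}=\kappa\,\Delta(p_0,p_1,p_2,p_3)$, and $Q$ is the only $Sp_6(\mathbb A)$-invariant polynomial on $\mathcal Z_2(\mathbb A)$ with this restriction to $\Delta_{\mathcal Z}$.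
   Context: $\mathcal J_3(\mathbb A)$ is the complex vector space of $3\times3$ $\mathbb A$-Hermitian matrices (diagonal entries in $\mathbb C$, the $(i,j)$ and $(j,i)$ entries conjugate elements of $\mathbb A$), of dimension $3m+3$ with $m=\dim_{\mathbb C}\mathbb A=1,2,4,8$; it carries a cubic form, the determinant. $SL_3(\mathbb A)\subset GL_{\mathbb C}(\mathcal J_3(\mathbb A))$ is the group preserving the determinant (respectively of type $SL_3$, $SL_3\times SL_3$, $SL_6$, $E_6$); $\mathfrak h$ is its Lie algebra. $W^*$ is identified with $\mathcal J_3(\mathbb A)$ as a vector space through the trace form $(A,B)\mapsto \mathrm{trace}\,\tfrac12(AB+BA)$, and $I$ is the identity matrix. $\mathcal Z_2(\mathbb A)$ is the space of Zorn matrices $\begin{pmatrix} x & A \\ B & y \end{pmatrix}$, $x,y\in\mathbb C$, $A,B\in\mathcal J_3(\mathbb A)$, of dimension $6m+8$. $C\in S^3W^*$ is a nonzero multiple of the (polarized) determinant, $C^*\in S^3W$ a nonzero multiple of the dual invariant cubic. $C(rst)$ is the value of the symmetric trilinear form, $C(rs)=C(r,s,\cdot)\in W^*$, and similarly for $C^*$; powers denote repeated arguments. They are normalized so that $2\langle C^*(s^*C(rt)),C(r^2)\rangle=\langle t,s^*\rangle C(r^3)+3\langle r,s^*\rangle C(r^2t)$ for all $r,t\in W$, $s^*\in W^*$. $Sp_6(\mathbb A)$ denotes respectively $Sp_6$, $SL_6$, $Spin_{12}$, $E_7$, acting irreducibly on $\mathcal Z_2(\mathbb A)$. Its Lie algebra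 is $\mathfrak h\oplus\mathbb C\oplus W\oplus W^*$, where $\mathfrak h$ acts naturally on each of the four summands of $\mathcal Z_2(\mathbb A)$ (trivially on the one-dimensional ones), $1\in\mathbb C$ acts by $-\frac32,-\frac12,\frac12,\frac32$ on the four summands, and $t\in W$, $t^*\in W^*$ act by $t.(\alpha,r,s^*,\beta^* )=(0,3\alpha t,C(rt),\frac12\langle t,s^*\rangle)$ and $t^*.(\alpha,r,s^*,\beta^* )=(\frac12\langle r,t^*\rangle,C^*(s^*t^* ),3\beta^*t^*,0)$. The classical discriminant of $p_0x^3+p_1x^2+p_2x+p_3$ (up to sign) is $\Delta=3(3p_0p_3-p_1p_2)^2+4(p_0p_2^3+p_1^3p_3)-4p_1^2p_2^2$. *)

theory Defs
  imports "HOL-Analysis.Analysis"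
begin

section \<open>Complex vector spaces\<close>

class complex_space = real_normed_vector +
  fixes scaleC :: "complex \<Rightarrow> 'a \<Rightarrow> 'a"  (infixr \<open>*\<^sub>C\<close> 75)
  assumes scaleC_add_right: "c *\<^sub>C (x + y) = c *\<^sub>C x + c *\<^sub>C y"
    and scaleC_add_left: "(c + d) *\<^sub>C x = c *\<^sub>C x + d *\<^sub>C x"
    and scaleC_scaleC: "c *\<^sub>C d *\<^sub>C x = (c * d) *\<^sub>C x"
    and scaleC_of_real: "complex_of_real a *\<^sub>C x = a *\<^sub>R x"

instantiation complex :: complex_space
begin
definition scaleC_complex :: "complex \<Rightarrow> complex \<Rightarrow> complex" where
  "scaleC_complex c x = c * x"
instance
  by standard (simp_all add: scaleC_complex_def algebra_simps scaleR_conv_of_real)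
end

instantiation prod :: (complex_space, complex_space) complex_space
begin
definition scaleC_prod :: "complex \<Rightarrow> 'a \<times> 'b \<Rightarrow> 'a \<times> 'b" where
  "scaleC_prod c x = (c *\<^sub>C fst x, c *\<^sub>C snd x)"
instance
  by standard
    (simp_all add: scaleC_prod_def scaleC_add_right scaleC_add_left scaleC_scaleC
      scaleC_of_real scaleR_prod_def)
end

instantiation vec :: (complex_space, finite) complex_space
begin
definition scaleC_vec :: "complex \<Rightarrow> 'a ^ 'b \<Rightarrow> 'a ^ 'b" where
  "scaleC_vec c x = (\<chi> i. c *\<^sub>C (x $ i))"
instance
  by standard
    (simp_all add: scaleC_vec_def vec_eq_iff scaleC_add_right scaleC_add_left scaleC_scaleC
      scaleC_of_real)
end

text \<open>The spaces of interest are complex subspaces \<open>V\<close> of an ambient type. Maps on \<open>V\<close> are total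
  functions whose values outside \<open>V\<close> are irrelevant.\<close>

definition clinear_on :: "'a::complex_space set \<Rightarrow> 'b::complex_space set \<Rightarrow> ('a \<Rightarrow> 'b) \<Rightarrow> bool" where
  "clinear_on V U f \<longleftrightarrow> f ` V \<subseteq> U \<and> (\<forall>x\<in>V. \<forall>y\<in>V. f (x + y) = f x + f y) \<and>
     (\<forall>c. \<forall>x\<in>V. f (c *\<^sub>C x) = c *\<^sub>C f x)"

text \<open>Polynomial functions on \<open>V\<close>: the algebra generated by the linear forms on \<open>V\<close>.\<close>

inductive polynomial_on :: "'a::complex_space set \<Rightarrow> ('a \<Rightarrow> complex) \<Rightarrow> bool" for V where
  poly_const: "polynomial_on V (\<lambda>_. c)"
| poly_linear: "clinear_on V UNIV f \<Longrightarrow> polynomial_on V f"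
| poly_add: "polynomial_on V P \<Longrightarrow> polynomial_on V R \<Longrightarrow> polynomial_on V (\<lambda>w. P w + R w)"
| poly_mult: "polynomial_on V P \<Longrightarrow> polynomial_on V R \<Longrightarrow> polynomial_on V (\<lambda>w. P w * R w)"

definition invariant_on :: "'a set \<Rightarrow> ('a \<Rightarrow> 'a) set \<Rightarrow> ('a \<Rightarrow> complex) \<Rightarrow> bool" where
  "invariant_on V G P \<longleftrightarrow> (\<forall>g\<in>G. \<forall>w\<in>V. P (g w) = P w)"

definition op_exp :: "('a::complex_space \<Rightarrow> 'a) \<Rightarrow> 'a \<Rightarrow> 'a" where
  "op_exp X v = (\<Sum>n. (X ^^ n) v /\<^sub>R fact n)"

text \<open>The Lie algebra of a closed subgroup \<open>G\<close> of \<open>GL(V)\<close>.\<close>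

definition lie_algebra_of :: "'a::complex_space set \<Rightarrow> ('a \<Rightarrow> 'a) set \<Rightarrow> ('a \<Rightarrow> 'a) set" where
  "lie_algebra_of V G =
     {X. clinear_on V V X \<and> (\<forall>a::real. op_exp (\<lambda>v. a *\<^sub>R X v) \<in> G)}"

text \<open>The subgroup generated by the exponentials of a Lie algebra \<open>L\<close> of operators, i.e. the
  connected Lie group with Lie algebra \<open>L\<close>. It is closed under inverses because \<open>L\<close> is closed
  under negation.\<close>

inductive_set generated_group :: "('a::complex_space \<Rightarrow> 'a) set \<Rightarrow> ('a \<Rightarrow> 'a) set" for L where
  gen_id: "id \<in> generated_group L"
| gen_exp: "X \<in> L \<Longrightarrow> g \<in> generated_group L \<Longrightarrow> op_exp X \<circ> g \<in> generated_group L"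

section \<open>The four complex composition algebras\<close>

text \<open>Cayley--Dickson doubling of an algebra with product \<open>m\<close> and conjugation \<open>c\<close>. Starting
  from \<open>\<real>\<close> with trivial conjugation it yields \<open>\<real>, \<complex>, \<bbbH>, \<bbbO>\<close> in succession. The structure
  constants are integers, so the same doubling over complex scalars, again starting with the
  trivial conjugation, gives the complexifications of these four algebras, with the
  complex-linear extension of their conjugations.\<close>

definition cd_mult :: "('a::ab_group_add \<Rightarrow> 'a \<Rightarrow> 'a) \<Rightarrow> ('a \<Rightarrow> 'a) \<Rightarrow> 'a \<times> 'a \<Rightarrow> 'a \<times> 'a \<Rightarrow> 'a \<times> 'a" where
  "cd_mult m c = (\<lambda>(a, b) (x, y). (m a x - m (c y) b, m y a + m b (c x)))"

definition cd_conj :: "('a::ab_group_add \<Rightarrow> 'a) \<Rightarrow> 'a \<times> 'a \<Rightarrow> 'a \<times> 'a" where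
  "cd_conj c = (\<lambda>(a, b). (c a, - b))"

type_synonym oct = "((complex \<times> complex) \<times> (complex \<times> complex)) \<times> ((complex \<times> complex) \<times> (complex \<times> complex))"

definition oct_mult :: "oct \<Rightarrow> oct \<Rightarrow> oct" where
  "oct_mult = cd_mult (cd_mult (cd_mult (*) id) (cd_conj id)) (cd_conj (cd_conj id))"

definition oct_conj :: "oct \<Rightarrow> oct" where
  "oct_conj = cd_conj (cd_conj (cd_conj id))"

definition oct_of :: "complex \<Rightarrow> oct" where
  "oct_of a = (((a, 0), 0), 0)"

text \<open>The coefficient of the unit, i.e. half of \<open>x + oct_conj x\<close>; a left inverse of \<^const>\<open>oct_of\<close>.\<close>

definition oct_re :: "oct \<Rightarrow> complex" where
  "oct_re x = fst (fst (fst x))"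

definition oct_norm :: "oct \<Rightarrow> complex" where
  "oct_norm x = oct_re (oct_mult x (oct_conj x))"

text \<open>\<open>\<real> \<otimes> \<complex>\<close>, \<open>\<complex> \<otimes> \<complex>\<close>, \<open>\<bbbH> \<otimes> \<complex>\<close> and \<open>\<bbbO> \<otimes> \<complex>\<close>, as nested subalgebras of the last one.\<close>

definition alg_R :: "oct set" where "alg_R = range (\<lambda>a. (((a, 0), 0), 0))"
definition alg_C :: "oct set" where "alg_C = range (\<lambda>z. ((z, 0), 0))"
definition alg_H :: "oct set" where "alg_H = range (\<lambda>q. (q, 0))"
definition alg_O :: "oct set" where "alg_O = UNIV"

section \<open>Hermitian matrices and the determinant\<close>

type_synonym omat = "oct ^ 3 ^ 3"

definition J3 :: "oct set \<Rightarrow> omat set" where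
  "J3 A = {M. (\<forall>i j. M $ i $ j \<in> A) \<and> (\<forall>i. M $ i $ i \<in> range oct_of) \<and>
              (\<forall>i j. M $ j $ i = oct_conj (M $ i $ j))}"

definition omat_mult :: "omat \<Rightarrow> omat \<Rightarrow> omat" where
  "omat_mult M N = (\<chi> i j. \<Sum>k\<in>UNIV. oct_mult (M $ i $ k) (N $ k $ j))"

definition omat_one :: omat where
  "omat_one = (\<chi> i j. if i = j then oct_of 1 else 0)"

definition jordan :: "omat \<Rightarrow> omat \<Rightarrow> omat" where
  "jordan M N = (1 / 2) *\<^sub>C (omat_mult M N + omat_mult N M)"

text \<open>On Hermitian matrices the trace is a multiple of the unit, and \<^const>\<open>oct_re\<close> reads it as a
  complex number.\<close>

definition trace_form :: "omat \<Rightarrow> omat \<Rightarrow> complex" where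
  "trace_form M N = oct_re (\<Sum>i\<in>UNIV. jordan M N $ i $ i)"

text \<open>Freudenthal's formula; the scalar part of a triple product does not depend on bracketing.\<close>

definition jdet :: "omat \<Rightarrow> complex" where
  "jdet M =
     oct_re (M $ 1 $ 1) * oct_re (M $ 2 $ 2) * oct_re (M $ 3 $ 3)
     - oct_re (M $ 1 $ 1) * oct_norm (M $ 2 $ 3)
     - oct_re (M $ 2 $ 2) * oct_norm (M $ 3 $ 1)
     - oct_re (M $ 3 $ 3) * oct_norm (M $ 1 $ 2)
     + 2 * oct_re (oct_mult (oct_mult (M $ 1 $ 2) (M $ 2 $ 3)) (M $ 3 $ 1))"

text \<open>Polarization, normalized so that \<open>jdet_polar r r r = jdet r\<close>.\<close>

definition jdet_polar :: "omat \<Rightarrow> omat \<Rightarrow> omat \<Rightarrow> complex" where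
  "jdet_polar r s t =
     (jdet (r + s + t) - jdet (r + s) - jdet (s + t) - jdet (r + t) + jdet r + jdet s + jdet t) / 6"

definition SL3 :: "oct set \<Rightarrow> (omat \<Rightarrow> omat) set" where
  "SL3 A = {g. clinear_on (J3 A) (J3 A) g \<and> bij_betw g (J3 A) (J3 A) \<and> (\<forall>r\<in>J3 A. jdet (g r) = jdet r)}"

text \<open>Throughout, \<open>W = J3 A\<close>, and the dual \<open>W\<^sup>*\<close> is \<open>J3 A\<close> too, with the pairing \<^const>\<open>trace_form\<close>
  (which is symmetric and nondegenerate on \<open>J3 A\<close>). Hence group and Lie algebra elements act on
  \<open>W\<^sup>*\<close> by inverse, respectively negative, transposes.\<close>

definition dual_group_act :: "oct set \<Rightarrow> (omat \<Rightarrow> omat) \<Rightarrow> omat \<Rightarrow> omat" where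
  "dual_group_act A g s = (THE v. v \<in> J3 A \<and> (\<forall>r\<in>J3 A. trace_form (g r) v = trace_form r s))"

definition dual_lie_act :: "oct set \<Rightarrow> (omat \<Rightarrow> omat) \<Rightarrow> omat \<Rightarrow> omat" where
  "dual_lie_act A X s = (THE v. v \<in> J3 A \<and> (\<forall>r\<in>J3 A. trace_form r v = - trace_form (X r) s))"

section \<open>The cubics on W and its dual\<close>

type_synonym trilinear = "omat \<Rightarrow> omat \<Rightarrow> omat \<Rightarrow> complex"

definition symmetric_trilinear_on :: "omat set \<Rightarrow> trilinear \<Rightarrow> bool" where
  "symmetric_trilinear_on V C \<longleftrightarrow>
     (\<forall>r\<in>V. \<forall>s\<in>V. \<forall>t\<in>V. C r s t = C s r t \<and> C r s t = C r t s) \<and>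
     (\<forall>s\<in>V. \<forall>t\<in>V. clinear_on V UNIV (\<lambda>r. C r s t))"

definition det_multiple :: "oct set \<Rightarrow> trilinear \<Rightarrow> bool" where
  "det_multiple A C \<longleftrightarrow>
     (\<exists>a. a \<noteq> 0 \<and> (\<forall>r\<in>J3 A. \<forall>s\<in>J3 A. \<forall>t\<in>J3 A. C r s t = a * jdet_polar r s t))"

text \<open>A nonzero cubic on \<open>W\<^sup>*\<close> invariant under the contragredient action of \<^const>\<open>SL3\<close>; the
  invariants in the third symmetric power of \<open>W\<close> form a line.\<close>

definition dual_invariant_cubic :: "oct set \<Rightarrow> trilinear \<Rightarrow> bool" where
  "dual_invariant_cubic A D \<longleftrightarrow>
     symmetric_trilinear_on (J3 A) D \<and>
     (\<exists>r\<in>J3 A. \<exists>s\<in>J3 A. \<exists>t\<in>J3 A. D r s t \<noteq> 0) \<and>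
     (\<forall>g\<in>SL3 A. \<forall>r\<in>J3 A. \<forall>s\<in>J3 A. \<forall>t\<in>J3 A.
        D (dual_group_act A g r) (dual_group_act A g s) (dual_group_act A g t) = D r s t)"

text \<open>\<open>contract A C r s\<close> is \<open>C(r, s, \<cdot>)\<close>, an element of \<open>W\<^sup>*\<close> if \<open>C\<close> is a form on \<open>W\<close> and of \<open>W\<close>
  if \<open>C\<close> is a form on \<open>W\<^sup>*\<close>.\<close>

definition contract :: "oct set \<Rightarrow> trilinear \<Rightarrow> omat \<Rightarrow> omat \<Rightarrow> omat" where
  "contract A C r s = (THE u. u \<in> J3 A \<and> (\<forall>t\<in>J3 A. trace_form t u = C r s t))"

definition normalized :: "oct set \<Rightarrow> trilinear \<Rightarrow> trilinear \<Rightarrow> bool" where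
  "normalized A C D \<longleftrightarrow> (\<forall>r\<in>J3 A. \<forall>t\<in>J3 A. \<forall>s\<in>J3 A.
     2 * trace_form (contract A D s (contract A C r t)) (contract A C r r) =
       trace_form t s * C r r r + 3 * trace_form r s * C r r t)"

section \<open>Zorn matrices, the group Sp6 and the quartic form\<close>

text \<open>The quadruple \<open>(\<alpha>, r, s, \<beta>)\<close> stands for \<open>(\<alpha>, r, s\<^sup>*, \<beta>\<^sup>*)\<close>.\<close>

type_synonym zorn = "complex \<times> omat \<times> omat \<times> complex"

definition Z2 :: "oct set \<Rightarrow> zorn set" where
  "Z2 A = UNIV \<times> J3 A \<times> J3 A \<times> UNIV"

text \<open>The action of \<open>X + c + t + u\<close> with \<open>X\<close> in the Lie algebra of \<^const>\<open>SL3\<close>, \<open>c\<close> a scalar,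
  \<open>t \<in> W\<close> and \<open>u \<in> W\<^sup>*\<close>.\<close>

definition zorn_act ::
  "oct set \<Rightarrow> trilinear \<Rightarrow> trilinear \<Rightarrow> (omat \<Rightarrow> omat) \<Rightarrow> complex \<Rightarrow> omat \<Rightarrow> omat \<Rightarrow> zorn \<Rightarrow> zorn" where
  "zorn_act A C D X c t u = (\<lambda>(\<alpha>, r, s, \<beta>).
     (0, X r, dual_lie_act A X s, 0)
     + (- (3 / 2) * c * \<alpha>, (- (1 / 2) * c) *\<^sub>C r, (1 / 2 * c) *\<^sub>C s, 3 / 2 * c * \<beta>)
     + (0, (3 * \<alpha>) *\<^sub>C t, contract A C r t, 1 / 2 * trace_form t s)
     + (1 / 2 * trace_form r u, contract A D s u, (3 * \<beta>) *\<^sub>C u, 0))"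

definition sp6 :: "oct set \<Rightarrow> trilinear \<Rightarrow> trilinear \<Rightarrow> (zorn \<Rightarrow> zorn) set" where
  "sp6 A C D = {zorn_act A C D X c t u | X c t u.
     X \<in> lie_algebra_of (J3 A) (SL3 A) \<and> t \<in> J3 A \<and> u \<in> J3 A}"

text \<open>The image of the connected group in \<open>GL(Z2 A)\<close>.\<close>

definition Sp6 :: "oct set \<Rightarrow> trilinear \<Rightarrow> trilinear \<Rightarrow> (zorn \<Rightarrow> zorn) set" where
  "Sp6 A C D = generated_group (sp6 A C D)"

definition quartic :: "oct set \<Rightarrow> trilinear \<Rightarrow> trilinear \<Rightarrow> zorn \<Rightarrow> complex" where
  "quartic A C D = (\<lambda>(\<alpha>, r, s, \<beta>).
     (3 * \<alpha> * \<beta> - 1 / 2 * trace_form r s)^2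
     + 1 / 3 * (\<beta> * C r r r + \<alpha> * D s s s)
     - 1 / 6 * trace_form (contract A D s s) (contract A C r r))"

text \<open>The classical discriminant of \<open>p0 x^3 + p1 x^2 + p2 x + p3\<close>, up to sign.\<close>

definition cubic_disc :: "complex \<Rightarrow> complex \<Rightarrow> complex \<Rightarrow> complex \<Rightarrow> complex" where
  "cubic_disc p0 p1 p2 p3 =
     3 * (3 * p0 * p3 - p1 * p2)^2 + 4 * (p0 * p2^3 + p1^3 * p3) - 4 * p1^2 * p2^2"

text \<open>\<open>P\<close> restricts to the subspace of all \<open>(\<alpha>, x I, y I, \<beta>)\<close> as \<open>\<kappa>\<close> times the discriminant
  of the cubic with coefficients \<open>\<alpha>, \<lambda> x, \<mu> y, \<beta>\<close>.\<close>

definition restricts_to_disc :: "complex \<Rightarrow> complex \<Rightarrow> complex \<Rightarrow> (zorn \<Rightarrow> complex) \<Rightarrow> bool" where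
  "restricts_to_disc l m k P \<longleftrightarrow> (\<forall>\<alpha> x y \<beta>.
     P (\<alpha>, x *\<^sub>C omat_one, y *\<^sub>C omat_one, \<beta>) = k * cubic_disc \<alpha> (l * x) (m * y) \<beta>)"

end

theory Submission
  imports Defs
begin

text \<open>Write \<open>W = J3 A\<close>, with its dual identified with \<open>W\<close> by the trace form, and let \<open>c\<close>, \<open>d\<close> be the
  contractions of \<open>C\<close>, \<open>D\<close>. Here \<open>C\<close> is \<open>a\<close> times the polarized determinant.

  The structure of \<open>A\<close> enters only through the cubic norm structure of \<open>W\<close>: the trace form
  represents all linear forms (\<open>trace_form_riesz\<close>), and the adjoint, the gradient of the determinant,
  satisfies \<open>jadj (jadj r) = jdet r *\<^sub>C r\<close> (\<open>jadj_jadj\<close>), which rests on the Moufang identity for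
  octonions. Inserting adjoints into the normalization identifies \<open>D\<close> as \<open>54 / a\<close> times the polarized
  determinant (\<open>normalized_dual_det\<close>). The normalization is therefore symmetric in \<open>C\<close> and \<open>D\<close>
  (\<open>normDC\<close>), and the restriction of the quartic to multiples of the identity can be compared with
  the discriminant (\<open>quartic_restricts_to_disc\<close>).

  Invariance of the quartic under the generating exponentials is equivalent to the vanishing of its
  derivative along the Lie algebra. The derivative is linear in the four summands; on the scalars it
  vanishes by weights, on \<open>W\<close> and its dual by the two forms of the normalization, and on the Lie
  algebra of the group of the determinant because these operators annihilate both cubics
  (\<open>quartic_deriv_zorn_act\<close>, \<open>quartic_invariant\<close>).

  For uniqueness it has to be shown that an invariant polynomial \<open>F\<close> that vanishes on all
  \<open>(\<alpha>, x I, y I, \<beta>)\<close> vanishes identically (\<open>invariant_zero\<close>). If \<open>\<alpha> \<noteq> 0\<close>, an exponential of an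
  element of \<open>W\<close> makes the second entry 0. By the normalization the operators
  \<open>r \<mapsto> 2 d(u, c(r, t)) - 3\<langle>r, u\<rangle> t - \<langle>t, u\<rangle> r\<close> belong to the Lie algebra of the group of the
  determinant, and they act transitively on tangent vectors to the level sets of \<open>D\<close> away from its
  zeros (\<open>annihilators_transitive\<close>). Hence \<open>F(\<alpha>, 0, s, \<beta>)\<close> is constant along curves of \<open>s\<close> in a level
  set, and those starting at multiples of \<open>I\<close> reach all \<open>s\<close> on a segment of any line through \<open>I\<close>
  (\<open>invariant_zero_on_slice\<close>). What remains follows since a polynomial function that vanishes on a
  Zariski dense set is zero.

  Differentiation is always along curves inside a complex subspace, because polynomial functions and
  linear operators on a subspace have arbitrary values outside it.\<close>

section \<open>Complex subspaces and complex-linear maps\<close>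

definition complex_subspace :: "'a::complex_space set \<Rightarrow> bool" where
  "complex_subspace V \<longleftrightarrow>
     0 \<in> V \<and> (\<forall>x\<in>V. \<forall>y\<in>V. x + y \<in> V) \<and> (\<forall>c. \<forall>x\<in>V. c *\<^sub>C x \<in> V)"

lemma scaleC_one [simp]: "1 *\<^sub>C x = (x::'a::complex_space)"
  using scaleC_of_real[of 1 x] by simp

lemma scaleC_zero_left [simp]: "0 *\<^sub>C x = (0::'a::complex_space)"
  using scaleC_of_real[of 0 x] by simp

lemma scaleC_minus_one: "(-1) *\<^sub>C x = - (x::'a::complex_space)"
  using scaleC_of_real[of "-1" x] by simp

lemma scaleC_zero_right [simp]: "c *\<^sub>C 0 = (0::'a::complex_space)"
  using scaleC_add_right[of c 0 "0::'a"] by simp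

lemma scaleC_minus_left: "(- c) *\<^sub>C x = - (c *\<^sub>C (x::'a::complex_space))"
  using scaleC_add_left[of c "-c" x] by (simp add: eq_neg_iff_add_eq_0 add.commute)

lemma scaleC_minus_right: "c *\<^sub>C (- x) = - (c *\<^sub>C (x::'a::complex_space))"
  using scaleC_add_right[of c x "-x"] by (simp add: eq_neg_iff_add_eq_0 add.commute)

lemma scaleC_diff_left: "(c - d) *\<^sub>C x = c *\<^sub>C x - d *\<^sub>C (x::'a::complex_space)"
  using scaleC_add_left[of c "-d" x] by (simp add: scaleC_minus_left)

lemma scaleC_diff_right: "c *\<^sub>C (x - y) = c *\<^sub>C x - c *\<^sub>C (y::'a::complex_space)"
  using scaleC_add_right[of c x "-y"] by (simp add: scaleC_minus_right)

lemma scaleR_eq_scaleC: "a *\<^sub>R x = complex_of_real a *\<^sub>C (x::'a::complex_space)"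
  by (simp add: scaleC_of_real)

lemma scaleR_scaleC: "a *\<^sub>R c *\<^sub>C x = c *\<^sub>C a *\<^sub>R (x::'a::complex_space)"
  by (simp add: scaleR_eq_scaleC scaleC_scaleC mult.commute)

lemma
  assumes "complex_subspace V"
  shows csubspace_zero: "0 \<in> V"
    and csubspace_add: "x \<in> V \<Longrightarrow> y \<in> V \<Longrightarrow> x + y \<in> V"
    and csubspace_scaleC: "x \<in> V \<Longrightarrow> c *\<^sub>C x \<in> V"
    and csubspace_scaleR: "x \<in> V \<Longrightarrow> a *\<^sub>R x \<in> V"
    and csubspace_minus: "x \<in> V \<Longrightarrow> - x \<in> V"
    and csubspace_diff: "x \<in> V \<Longrightarrow> y \<in> V \<Longrightarrow> x - y \<in> V"
proof -
  show 1: "0 \<in> V" and 2: "x \<in> V \<Longrightarrow> y \<in> V \<Longrightarrow> x + y \<in> V" and 3: "x \<in> V \<Longrightarrow> c *\<^sub>C x \<in> V" for x y c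
    using assms by (auto simp: complex_subspace_def)
  show "x \<in> V \<Longrightarrow> a *\<^sub>R x \<in> V"
    by (simp add: scaleR_eq_scaleC 3)
  show 4: "x \<in> V \<Longrightarrow> - x \<in> V" for x
    using 3[of x "-1"] by (simp add: scaleC_minus_one)
  show "x \<in> V \<Longrightarrow> y \<in> V \<Longrightarrow> x - y \<in> V"
    using 2[of x "-y"] 4[of y] by simp
qed

lemma complex_subspace_UNIV: "complex_subspace UNIV"
  by (simp add: complex_subspace_def)

lemma complex_subspace_Times:
  "complex_subspace V \<Longrightarrow> complex_subspace U \<Longrightarrow> complex_subspace (V \<times> U)"
  by (auto simp: complex_subspace_def scaleC_prod_def zero_prod_def)

lemma csubspace_subspace: "complex_subspace V \<Longrightarrow> subspace V"
  by (simp add: subspace_def csubspace_zero csubspace_add csubspace_scaleR)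

lemma
  assumes "clinear_on V U f"
  shows clinear_on_mem: "x \<in> V \<Longrightarrow> f x \<in> U"
    and clinear_on_add: "x \<in> V \<Longrightarrow> y \<in> V \<Longrightarrow> f (x + y) = f x + f y"
    and clinear_on_scaleC: "x \<in> V \<Longrightarrow> f (c *\<^sub>C x) = c *\<^sub>C f x"
    and clinear_on_scaleR: "x \<in> V \<Longrightarrow> f (a *\<^sub>R x) = a *\<^sub>R f x"
    and clinear_on_minus: "x \<in> V \<Longrightarrow> f (- x) = - f x"
proof -
  show "x \<in> V \<Longrightarrow> f x \<in> U"
    and "x \<in> V \<Longrightarrow> y \<in> V \<Longrightarrow> f (x + y) = f x + f y"
    and scale: "x \<in> V \<Longrightarrow> f (c *\<^sub>C x) = c *\<^sub>C f x" for c
    using assms unfolding clinear_on_def by auto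
  show "x \<in> V \<Longrightarrow> f (a *\<^sub>R x) = a *\<^sub>R f x"
    by (simp add: scaleR_eq_scaleC scale)
  show "x \<in> V \<Longrightarrow> f (- x) = - f x"
    using scale[of "-1"] by (simp add: scaleC_minus_one)
qed

lemma clinear_on_zero: "clinear_on V U f \<Longrightarrow> complex_subspace V \<Longrightarrow> f 0 = 0"
  using clinear_on_scaleC[of V U f 0 0] by (simp add: csubspace_zero)

lemma clinear_on_diff:
  "clinear_on V U f \<Longrightarrow> complex_subspace V \<Longrightarrow> x \<in> V \<Longrightarrow> y \<in> V \<Longrightarrow> f (x - y) = f x - f y"
  using clinear_on_add[of V U f x "-y"] clinear_on_minus[of V U f y] csubspace_minus[of V y] by simp

lemma clinear_on_comp:
  "clinear_on V U f \<Longrightarrow> clinear_on U Z g \<Longrightarrow> clinear_on V Z (\<lambda>x. g (f x))"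
  unfolding clinear_on_def by (auto simp: image_subset_iff)

lemma clinear_onI:
  assumes "\<And>x. x \<in> V \<Longrightarrow> f x \<in> U" "\<And>x y. x \<in> V \<Longrightarrow> y \<in> V \<Longrightarrow> f (x + y) = f x + f y"
    "\<And>c x. x \<in> V \<Longrightarrow> f (c *\<^sub>C x) = c *\<^sub>C f x"
  shows "clinear_on V U f"
  using assms by (auto simp: clinear_on_def)

text \<open>A map that is linear on a subspace is there the restriction of a linear map of the whole
  space, hence of a bounded one.\<close>

lemma linear_extension:
  fixes V :: "'a::{complex_space,euclidean_space} set"
  assumes V: "complex_subspace V" and f: "clinear_on V U f"
  obtains F where "linear F" "\<And>x. x \<in> V \<Longrightarrow> F x = f x" "\<And>x. F x \<in> f ` V"
proof -
  have "\<exists>g. g ` UNIV \<subseteq> V \<and> linear g \<and> (\<forall>v\<in>V. g (id v) = v)"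
    by (rule linear_exists_left_inverse_on)
      (auto simp: csubspace_subspace[OF V] linear_id[unfolded id_def] id_def)
  then obtain g where g: "range g \<subseteq> V" "linear g" "\<And>v. v \<in> V \<Longrightarrow> g v = v"
    by auto
  have "linear (\<lambda>x. f (g x))"
    using g(1) linear_add[OF g(2)] linear_cmul[OF g(2)]
    by (intro linearI) (auto simp: clinear_on_add[OF f] clinear_on_scaleR[OF f] image_subset_iff)
  then show ?thesis
    using g(1,3) by (intro that[of "\<lambda>x. f (g x)"]) auto
qed

section \<open>Polynomial functions along lines and curves\<close>

lemma polynomial_on_diff: "polynomial_on V f \<Longrightarrow> polynomial_on V g \<Longrightarrow> polynomial_on V (\<lambda>w. f w - g w)"
  using poly_add[of V f "\<lambda>w. (-1) * g w"] poly_mult[OF poly_const[of V "-1"], of g] by simp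

lemma polynomial_on_power: "polynomial_on V f \<Longrightarrow> polynomial_on V (\<lambda>w. f w ^ n)"
  by (induction n) (auto intro: poly_const poly_mult)

lemma polynomial_on_sum:
  "(\<And>i. i \<in> I \<Longrightarrow> polynomial_on V (f i)) \<Longrightarrow> polynomial_on V (\<lambda>w. \<Sum>i\<in>I. f i w)"
  by (induction I rule: infinite_finite_induct) (auto intro: poly_const poly_add)

lemma polynomial_on_line:
  assumes V: "complex_subspace V" and "polynomial_on V P" and w: "w \<in> V" "v \<in> V"
  obtains q where "\<And>z. P (w + z *\<^sub>C v) = poly q z"
proof -
  from assms(2) have "\<exists>q. \<forall>z. P (w + z *\<^sub>C v) = poly q z"
  proof induction
    case (poly_const c)
    show ?case by (rule exI[of _ "[:c:]"]) simp
  next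
    case (poly_linear f)
    then show ?case
      using w V by (intro exI[of _ "[:f w, f v:]"])
        (simp add: clinear_on_add clinear_on_scaleC csubspace_scaleC scaleC_complex_def)
  next
    case (poly_add P R)
    then show ?case by (metis Polynomial.poly_add)
  next
    case (poly_mult P R)
    then show ?case by (metis Polynomial.poly_mult)
  qed
  then show ?thesis using that by blast
qed

text \<open>On the line through \<open>w\<close> and \<open>v\<close>, which meets \<open>v\<close> at parameter 1, the function is a
  polynomial in one variable, hence zero as soon as it has infinitely many zeros.\<close>

lemma polynomial_on_eq_zero_by_line:
  assumes V: "complex_subspace V" and P: "polynomial_on V P" and w: "w \<in> V" "v \<in> V"
    and "infinite {z. P (w + z *\<^sub>C (v - w)) = 0}"
  shows "P v = 0"
proof -
  obtain q where q: "\<And>z. P (w + z *\<^sub>C (v - w)) = poly q z"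
    using polynomial_on_line[OF V P w(1) csubspace_diff[OF V w(2,1)]] by metis
  have "q = 0"
    using assms(5) poly_roots_finite[of q] by (auto simp: q)
  then show ?thesis using q[of 1] by simp
qed

text \<open>Zariski density of the complement of a hypersurface: on the line from \<open>w\<close> to \<open>v\<close>, all but
  finitely many points satisfy \<open>R \<noteq> 0\<close>, and there \<open>P\<close> vanishes.\<close>

lemma polynomial_on_integral_domain:
  assumes V: "complex_subspace V" and P: "polynomial_on V P" and R: "polynomial_on V R"
    and prod: "\<And>v. v \<in> V \<Longrightarrow> R v \<noteq> 0 \<Longrightarrow> P v = 0" and w: "w \<in> V" "R w \<noteq> 0" and v: "v \<in> V"
  shows "P v = 0"
proof (rule polynomial_on_eq_zero_by_line[OF V P w(1) v])
  obtain q where q: "\<And>z. R (w + z *\<^sub>C (v - w)) = poly q z"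
    using polynomial_on_line[OF V R w(1) csubspace_diff[OF V v w(1)]] by metis
  have "q \<noteq> 0" using q[of 0] w by auto
  then have "infinite (UNIV - {z. poly q z = 0})"
    using poly_roots_finite[of q] infinite_UNIV_char_0 by (metis Diff_infinite_finite)
  moreover have "UNIV - {z. poly q z = 0} \<subseteq> {z. P (w + z *\<^sub>C (v - w)) = 0}"
  proof safe
    fix z assume "poly q z \<noteq> 0"
    moreover have "w + z *\<^sub>C (v - w) \<in> V"
      using V w v by (intro csubspace_add csubspace_scaleC csubspace_diff) auto
    ultimately show "P (w + z *\<^sub>C (v - w)) = 0" using prod q by auto
  qed
  ultimately show "infinite {z. P (w + z *\<^sub>C (v - w)) = 0}"
    using finite_subset by blast
qed

text \<open>The derivative of a polynomial along a curve in \<open>V\<close> depends only on the point and on the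
  velocity there. Values of \<open>P\<close> outside \<open>V\<close> are arbitrary, so differentiability of \<open>P\<close> itself
  is not available.\<close>

lemma polynomial_on_derivative:
  fixes V :: "'a::{complex_space,euclidean_space} set"
  assumes V: "complex_subspace V" and P: "polynomial_on V P" and w: "w \<in> V"
  obtains L :: "'a \<Rightarrow> complex" where
    "\<And>\<gamma> v a. range \<gamma> \<subseteq> V \<Longrightarrow> \<gamma> a = w \<Longrightarrow> (\<gamma> has_vector_derivative v) (at a) \<Longrightarrow>
       ((\<lambda>b. P (\<gamma> b)) has_vector_derivative L v) (at a)"
proof -
  from P have "\<exists>L. \<forall>\<gamma> v a. range \<gamma> \<subseteq> V \<longrightarrow> \<gamma> a = w \<longrightarrow> (\<gamma> has_vector_derivative v) (at a) \<longrightarrow>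
       ((\<lambda>b. P (\<gamma> b)) has_vector_derivative L v) (at (a::real))"
  proof induction
    case (poly_const c)
    show ?case by (rule exI[of _ "\<lambda>_. 0"]) auto
  next
    case (poly_linear f)
    obtain F where F: "linear F" "\<And>x. x \<in> V \<Longrightarrow> F x = f x"
      using linear_extension[OF V poly_linear] by metis
    have "bounded_linear F" using F(1) linear_conv_bounded_linear by blast
    show ?case
    proof (intro exI[of _ F] allI impI)
      fix \<gamma> v and a :: real
      assume \<gamma>: "range \<gamma> \<subseteq> V" "(\<gamma> has_vector_derivative v) (at a)"
      have "(\<lambda>b. f (\<gamma> b)) = (\<lambda>b. F (\<gamma> b))" using F(2) \<gamma>(1) by (auto simp: image_subset_iff)
      then show "((\<lambda>b. f (\<gamma> b)) has_vector_derivative F v) (at a)"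
        using bounded_linear.has_vector_derivative[OF \<open>bounded_linear F\<close> \<gamma>(2)] by simp
    qed
  next
    case (poly_add P R)
    then obtain L M where
      L: "\<And>\<gamma> v a. range \<gamma> \<subseteq> V \<Longrightarrow> \<gamma> a = w \<Longrightarrow> (\<gamma> has_vector_derivative v) (at a) \<Longrightarrow>
       ((\<lambda>b. P (\<gamma> b)) has_vector_derivative L v) (at (a::real))" and
      M: "\<And>\<gamma> v a. range \<gamma> \<subseteq> V \<Longrightarrow> \<gamma> a = w \<Longrightarrow> (\<gamma> has_vector_derivative v) (at a) \<Longrightarrow>
       ((\<lambda>b. R (\<gamma> b)) has_vector_derivative M v) (at (a::real))" by metis
    show ?case
    proof (intro exI[of _ "\<lambda>v. L v + M v"] allI impI)
      fix \<gamma> v and a :: real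
      assume \<gamma>: "range \<gamma> \<subseteq> V" "\<gamma> a = w" "(\<gamma> has_vector_derivative v) (at a)"
      show "((\<lambda>b. P (\<gamma> b) + R (\<gamma> b)) has_vector_derivative L v + M v) (at a)"
        by (rule has_vector_derivative_add[OF L[OF \<gamma>] M[OF \<gamma>]])
    qed
  next
    case (poly_mult P R)
    then obtain L M where
      L: "\<And>\<gamma> v a. range \<gamma> \<subseteq> V \<Longrightarrow> \<gamma> a = w \<Longrightarrow> (\<gamma> has_vector_derivative v) (at a) \<Longrightarrow>
       ((\<lambda>b. P (\<gamma> b)) has_vector_derivative L v) (at (a::real))" and
      M: "\<And>\<gamma> v a. range \<gamma> \<subseteq> V \<Longrightarrow> \<gamma> a = w \<Longrightarrow> (\<gamma> has_vector_derivative v) (at a) \<Longrightarrow>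
       ((\<lambda>b. R (\<gamma> b)) has_vector_derivative M v) (at (a::real))" by metis
    show ?case
    proof (intro exI[of _ "\<lambda>v. P w * M v + L v * R w"] allI impI)
      fix \<gamma> v and a :: real
      assume \<gamma>: "range \<gamma> \<subseteq> V" "\<gamma> a = w" "(\<gamma> has_vector_derivative v) (at a)"
      show "((\<lambda>b. P (\<gamma> b) * R (\<gamma> b)) has_vector_derivative P w * M v + L v * R w) (at a)"
        using has_vector_derivative_mult[OF L[OF \<gamma>] M[OF \<gamma>]] \<gamma>(2) by simp
    qed
  qed
  then show ?thesis using that by blast
qed

text \<open>In particular it may be computed along the straight line.\<close>

lemma polynomial_on_derivative_by_line:
  fixes V :: "'a::{complex_space,euclidean_space} set"
  assumes V: "complex_subspace V" and P: "polynomial_on V P"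
    and \<gamma>: "range \<gamma> \<subseteq> V" "(\<gamma> has_vector_derivative v) (at a)" and v: "v \<in> V"
    and line: "((\<lambda>e. P (\<gamma> a + e *\<^sub>R v)) has_vector_derivative d) (at 0)"
  shows "((\<lambda>b. P (\<gamma> b)) has_vector_derivative d) (at a)"
proof -
  have "\<gamma> a \<in> V" using \<gamma>(1) by auto
  then obtain L where L: "\<And>\<gamma>' v b. range \<gamma>' \<subseteq> V \<Longrightarrow> \<gamma>' b = \<gamma> a \<Longrightarrow>
      (\<gamma>' has_vector_derivative v) (at b) \<Longrightarrow> ((\<lambda>b. P (\<gamma>' b)) has_vector_derivative L v) (at b)"
    using polynomial_on_derivative[OF V P] by metis
  have "((\<lambda>e. \<gamma> a + e *\<^sub>R v) has_vector_derivative v) (at 0)"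
    by (auto intro!: derivative_eq_intros)
  moreover have "range (\<lambda>e. \<gamma> a + e *\<^sub>R v) \<subseteq> V"
    using \<open>\<gamma> a \<in> V\<close> v V by (auto intro!: csubspace_add csubspace_scaleR)
  ultimately have "((\<lambda>e. P (\<gamma> a + e *\<^sub>R v)) has_vector_derivative L v) (at 0)"
    by (intro L) auto
  then have "d = L v" using line vector_derivative_unique_at by blast
  then show ?thesis using L[OF \<gamma>(1) refl \<gamma>(2)] by simp
qed

section \<open>Exponentials of operators as flows\<close>

lemma funpow_mem: "(\<And>x. x \<in> V \<Longrightarrow> X x \<in> V) \<Longrightarrow> w \<in> V \<Longrightarrow> (X ^^ n) w \<in> V"
  by (induction n) auto

lemma op_exp_cong:
  assumes "\<And>x. x \<in> V \<Longrightarrow> X x = Y x" "\<And>x. x \<in> V \<Longrightarrow> X x \<in> V" "w \<in> V"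
  shows "op_exp X w = op_exp Y w"
proof -
  have "(X ^^ n) w = (Y ^^ n) w" for n
    using assms by (induction n) (auto simp: funpow_mem)
  then show ?thesis by (simp add: op_exp_def)
qed

text \<open>Each coordinate of the exponential is a power series in \<open>a\<close> that converges everywhere, by
  comparison with the exponential of an operator norm bound; termwise differentiation gives the
  differential equation.\<close>

lemma op_exp_flow_linear:
  fixes F :: "'a::{complex_space,euclidean_space} \<Rightarrow> 'a"
  assumes "linear F"
  shows "summable (\<lambda>n. ((\<lambda>v. a *\<^sub>R F v) ^^ n) w /\<^sub>R fact n)" (is ?sum)
    and "((\<lambda>a. op_exp (\<lambda>v. a *\<^sub>R F v) w) has_vector_derivative F (op_exp (\<lambda>v. a *\<^sub>R F v) w)) (at a)"
proof -
  have bl: "bounded_linear F" using assms linear_conv_bounded_linear by blast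
  interpret bounded_linear F by fact
  obtain K where K: "K > 0" "\<And>x. norm (F x) \<le> norm x * K" using pos_bounded by blast
  define u where "u n = (F ^^ n) w" for n
  have pow: "((\<lambda>v. a *\<^sub>R F v) ^^ n) w = a ^ n *\<^sub>R u n" for a n
    by (induction n) (auto simp: u_def scaleR)
  have nu: "norm (u n) \<le> norm w * K ^ n" for n
  proof (induction n)
    case (Suc n)
    have "norm (u (Suc n)) \<le> norm (u n) * K" by (simp add: u_def K)
    also have "\<dots> \<le> (norm w * K ^ n) * K" using Suc K(1) by (simp add: mult_right_mono)
    finally show ?case by (simp add: mult_ac)
  qed (simp add: u_def)
  have sumu: "summable (\<lambda>n. (a ^ n / fact n) *\<^sub>R u n)" for a
  proof (rule summable_comparison_test[OF _ summable_mult[OF summable_exp[of "\<bar>a\<bar> * K"], of "norm w"]])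
    have "norm ((a ^ n / fact n) *\<^sub>R u n) \<le> norm w * (inverse (fact n) * (\<bar>a\<bar> * K) ^ n)" for n
      using mult_left_mono[OF nu[of n], of "\<bar>a\<bar> ^ n / fact n"]
      by (simp add: power_abs power_mult_distrib field_simps)
    then show "\<exists>N. \<forall>n\<ge>N. norm ((a ^ n / fact n) *\<^sub>R u n) \<le> norm w * (inverse (fact n) * (\<bar>a\<bar> * K) ^ n)"
      by blast
  qed
  then show ?sum by (simp add: pow field_simps)
  define E where "E a = (\<Sum>n. (a ^ n / fact n) *\<^sub>R u n)" for a
  have E: "op_exp (\<lambda>v. a *\<^sub>R F v) w = E a" for a
    by (simp add: op_exp_def E_def pow field_simps)
  have sums: "(\<lambda>n. (a ^ n / fact n) *\<^sub>R u n) sums E a" for a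
    unfolding E_def using sumu by (rule summable_sums)
  have "((\<lambda>a. E a \<bullet> b) has_derivative (\<lambda>h. (h *\<^sub>R F (E a)) \<bullet> b)) (at a)" for b
  proof -
    define c where "c n = (u n \<bullet> b) / fact n" for n
    have Eb: "(\<lambda>n. c n * a ^ n) sums (E a \<bullet> b)" for a
      using bounded_linear.sums[OF bounded_linear_inner_left sums[of a], of b]
      by (simp add: c_def field_simps)
    then have "summable (\<lambda>n. c n * a ^ n)" for a
      by (rule sums_summable)
    from termdiffs_strong_converges_everywhere[OF this, of a]
    have D: "((\<lambda>a. \<Sum>n. c n * a ^ n) has_field_derivative (\<Sum>n. diffs c n * a ^ n)) (at a)" .
    have "(\<lambda>n. F ((a ^ n / fact n) *\<^sub>R u n) \<bullet> b) sums (F (E a) \<bullet> b)"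
      by (intro bounded_linear.sums[OF bounded_linear_inner_left] bounded_linear.sums[OF bl] sums)
    moreover have "F ((a ^ n / fact n) *\<^sub>R u n) \<bullet> b = diffs c n * a ^ n" for n
      by (simp add: diffs_def c_def scaleR u_def del: of_nat_Suc)
    ultimately have "(\<Sum>n. diffs c n * a ^ n) = F (E a) \<bullet> b"
      by (simp add: sums_iff)
    moreover have "(\<lambda>a. \<Sum>n. c n * a ^ n) = (\<lambda>a. E a \<bullet> b)"
      using Eb by (simp add: sums_iff fun_eq_iff)
    moreover have "(*) (F (E a) \<bullet> b) = (\<lambda>h. (h *\<^sub>R F (E a)) \<bullet> b)"
      by (simp add: fun_eq_iff)
    ultimately show ?thesis using D by (simp add: has_field_derivative_def)
  qed
  then show "((\<lambda>a. op_exp (\<lambda>v. a *\<^sub>R F v) w) has_vector_derivative F (op_exp (\<lambda>v. a *\<^sub>R F v) w)) (at a)"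
    unfolding E has_vector_derivative_def by (subst has_derivative_componentwise_within) auto
qed

lemma
  fixes V :: "'a::{complex_space,euclidean_space} set"
  assumes V: "complex_subspace V" and X: "clinear_on V V X"
  shows op_exp_mem: "w \<in> V \<Longrightarrow> op_exp (\<lambda>v. a *\<^sub>R X v) w \<in> V"
    and op_exp_flow: "w \<in> V \<Longrightarrow> ((\<lambda>a. op_exp (\<lambda>v. a *\<^sub>R X v) w) has_vector_derivative
           X (op_exp (\<lambda>v. a *\<^sub>R X v) w)) (at a)"
    and op_exp_linear: "clinear_on V V (op_exp (\<lambda>v. a *\<^sub>R X v))"
proof -
  obtain F where F: "linear F" "\<And>x. x \<in> V \<Longrightarrow> F x = X x"
    using linear_extension[OF V X] by metis
  have XV: "a *\<^sub>R X x \<in> V" if "x \<in> V" for x a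
    using that V clinear_on_mem[OF X] csubspace_scaleR by blast
  have eq: "op_exp (\<lambda>v. a *\<^sub>R X v) w = op_exp (\<lambda>v. a *\<^sub>R F v) w" if "w \<in> V" for w a
    by (rule op_exp_cong[of V]) (auto simp: F XV that)
  have pw: "((\<lambda>v. a *\<^sub>R X v) ^^ n) w \<in> V" if "w \<in> V" for w a n
    by (rule funpow_mem) (auto simp: XV that)
  have peq: "((\<lambda>v. a *\<^sub>R X v) ^^ n) w = ((\<lambda>v. a *\<^sub>R F v) ^^ n) w" if "w \<in> V" for w a n
  proof (induction n)
    case (Suc n)
    then show ?case using F(2)[OF pw[OF that, of n a]] by simp
  qed simp
  have sm: "summable (\<lambda>n. ((\<lambda>v. a *\<^sub>R X v) ^^ n) w /\<^sub>R fact n)" if "w \<in> V" for w a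
    using op_exp_flow_linear(1)[OF F(1)] peq[OF that] by simp
  show mem: "op_exp (\<lambda>v. a *\<^sub>R X v) w \<in> V" if "w \<in> V" for w a
  proof (rule closed_sequentially[OF closed_subspace[OF csubspace_subspace[OF V]]])
    show "(\<lambda>n. \<Sum>i<n. ((\<lambda>v. a *\<^sub>R X v) ^^ i) w /\<^sub>R fact i) \<longlonglongrightarrow> op_exp (\<lambda>v. a *\<^sub>R X v) w"
      unfolding op_exp_def by (rule summable_LIMSEQ[OF sm[OF that]])
    show "(\<Sum>i<n. ((\<lambda>v. a *\<^sub>R X v) ^^ i) w /\<^sub>R fact i) \<in> V" for n
      using pw[OF that] csubspace_subspace[OF V] by (intro subspace_sum subspace_scale) auto
  qed
  show "((\<lambda>a. op_exp (\<lambda>v. a *\<^sub>R X v) w) has_vector_derivative X (op_exp (\<lambda>v. a *\<^sub>R X v) w)) (at a)"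
    if "w \<in> V"
    using op_exp_flow_linear(2)[OF F(1)] that by (simp add: eq mem[OF that, unfolded eq[OF that]] flip: F(2))
  have padd: "((\<lambda>v. a *\<^sub>R X v) ^^ n) (x + y) = ((\<lambda>v. a *\<^sub>R X v) ^^ n) x + ((\<lambda>v. a *\<^sub>R X v) ^^ n) y"
    if "x \<in> V" "y \<in> V" for x y n
    by (induction n) (auto simp: clinear_on_add[OF X] pw that scaleR_add_right)
  have psc: "((\<lambda>v. a *\<^sub>R X v) ^^ n) (c *\<^sub>C x) = c *\<^sub>C ((\<lambda>v. a *\<^sub>R X v) ^^ n) x"
    if "x \<in> V" for x c n
    by (induction n) (auto simp: clinear_on_scaleC[OF X] pw that scaleR_scaleC)
  show "clinear_on V V (op_exp (\<lambda>v. a *\<^sub>R X v))"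
  proof (rule clinear_onI)
    fix x y assume "x \<in> V" "y \<in> V"
    then show "op_exp (\<lambda>v. a *\<^sub>R X v) (x + y) = op_exp (\<lambda>v. a *\<^sub>R X v) x + op_exp (\<lambda>v. a *\<^sub>R X v) y"
      unfolding op_exp_def by (simp add: padd scaleR_add_right suminf_add sm)
  next
    fix c x assume x: "x \<in> V"
    have "linear ((*\<^sub>C) c :: 'a \<Rightarrow> 'a)"
      by (intro linearI) (auto simp: scaleC_add_right scaleR_eq_scaleC scaleC_scaleC mult.commute)
    then have "bounded_linear ((*\<^sub>C) c :: 'a \<Rightarrow> 'a)" using linear_conv_bounded_linear by blast
    from bounded_linear.suminf[OF this sm[OF x]]
    show "op_exp (\<lambda>v. a *\<^sub>R X v) (c *\<^sub>C x) = c *\<^sub>C op_exp (\<lambda>v. a *\<^sub>R X v) x"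
      unfolding op_exp_def
      by (simp add: psc[OF x] scaleR_scaleC)
  qed (rule mem)
qed

lemma op_exp_zero: "op_exp (\<lambda>v. 0) w = w"
proof -
  have "((\<lambda>v::'a. 0::'a) ^^ n) w /\<^sub>R fact n = (if n = 0 then w else 0)" for n and w :: 'a
    by (cases n) auto
  then show "op_exp (\<lambda>v. 0) w = w" for w :: 'a
    unfolding op_exp_def using suminf_finite[of "{0}" "\<lambda>n. if n = 0 then w else 0"] by simp
qed

text \<open>Passage between invariance under the one-parameter group of \<open>X\<close> and vanishing of the
  derivative in the direction of \<open>X\<close>, first by integration and then by differentiation at 0. The
  velocity is all that matters, so that the second statement covers every curve tangent to \<open>X\<close>.\<close>

lemma polynomial_on_flow_invariant:
  fixes V :: "'a::{complex_space,euclidean_space} set"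
  assumes V: "complex_subspace V" and P: "polynomial_on V P" and X: "clinear_on V V X"
    and inf: "\<And>w. w \<in> V \<Longrightarrow> ((\<lambda>e. P (w + e *\<^sub>R X w)) has_vector_derivative 0) (at 0)"
    and w: "w \<in> V"
  shows "P (op_exp (\<lambda>v. a *\<^sub>R X v) w) = P w"
proof -
  let ?E = "\<lambda>a. op_exp (\<lambda>v. a *\<^sub>R X v) w"
  have E: "?E a \<in> V" for a using op_exp_mem[OF V X w] .
  have "((\<lambda>a. P (?E a)) has_vector_derivative 0) (at a)" for a
    by (rule polynomial_on_derivative_by_line[OF V P _ op_exp_flow[OF V X w]])
      (use E inf clinear_on_mem[OF X] in auto)
  then have "P (?E a) = P (?E 0)"
    by (intro has_derivative_zero_unique[of UNIV "\<lambda>a. P (?E a)"])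
      (auto simp: has_vector_derivative_def)
  then show ?thesis by (simp add: op_exp_zero)
qed

lemma polynomial_on_infinitesimal_invariant:
  fixes V :: "'a::{complex_space,euclidean_space} set"
  assumes V: "complex_subspace V" and P: "polynomial_on V P" and X: "clinear_on V V X"
    and inv: "\<And>a. P (op_exp (\<lambda>v. a *\<^sub>R X v) w) = P w" and w: "w \<in> V"
    and \<gamma>: "range \<gamma> \<subseteq> V" "\<gamma> a = w" "(\<gamma> has_vector_derivative X w) (at a)"
  shows "((\<lambda>b. P (\<gamma> b)) has_vector_derivative 0) (at a)"
proof -
  obtain L where L: "\<And>\<gamma>' v b. range \<gamma>' \<subseteq> V \<Longrightarrow> \<gamma>' b = w \<Longrightarrow>
      (\<gamma>' has_vector_derivative v) (at b) \<Longrightarrow> ((\<lambda>b. P (\<gamma>' b)) has_vector_derivative L v) (at b)"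
    using polynomial_on_derivative[OF V P w] by metis
  have "((\<lambda>a. P (op_exp (\<lambda>v. a *\<^sub>R X v) w)) has_vector_derivative L (X w)) (at 0)"
    using op_exp_flow[OF V X w, of 0] op_exp_mem[OF V X w] by (intro L) (auto simp: op_exp_zero)
  then have "((\<lambda>a::real. P w) has_vector_derivative L (X w)) (at 0)" by (simp add: inv)
  then have "L (X w) = 0"
    using vector_derivative_unique_at[OF _ has_vector_derivative_const] by blast
  then show ?thesis using L[OF \<gamma>] by simp
qed

section \<open>Octonions\<close>

text \<open>The symmetric bilinear form of the quadratic form \<^const>\<open>oct_norm\<close>; in coordinates it is the
  sum of the products of corresponding entries.\<close>

definition octB :: "oct \<Rightarrow> oct \<Rightarrow> complex" where
  "octB x y = oct_re (oct_mult x (oct_conj y))"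

lemma oct_cases:
  obtains a b c d e f g h where "(x::oct) = (((a, b), (c, d)), ((e, f), (g, h)))"
  by (metis surj_pair)

lemma oct_mult_eq: "oct_mult (((a0, a1), (a2, a3)), ((a4, a5), (a6, a7)))
   (((b0, b1), (b2, b3)), ((b4, b5), (b6, b7))) =
  (((a0*b0 - a1*b1 - a2*b2 - a3*b3 - a4*b4 - a5*b5 - a6*b6 - a7*b7,
     a0*b1 + a1*b0 + a2*b3 - a3*b2 + a4*b5 - a5*b4 - a6*b7 + a7*b6),
    (a0*b2 - a1*b3 + a2*b0 + a3*b1 + a4*b6 + a5*b7 - a6*b4 - a7*b5,
     a0*b3 + a1*b2 - a2*b1 + a3*b0 + a4*b7 - a5*b6 + a6*b5 - a7*b4)),
   ((a0*b4 - a1*b5 - a2*b6 - a3*b7 + a4*b0 + a5*b1 + a6*b2 + a7*b3,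
     a0*b5 + a1*b4 - a2*b7 + a3*b6 - a4*b1 + a5*b0 - a6*b3 + a7*b2),
    (a0*b6 + a1*b7 + a2*b4 - a3*b5 - a4*b2 + a5*b3 + a6*b0 - a7*b1,
     a0*b7 - a1*b6 + a2*b5 + a3*b4 - a4*b3 - a5*b2 + a6*b1 + a7*b0)))"
  by (simp add: oct_mult_def cd_mult_def cd_conj_def algebra_simps)

lemma oct_conj_eq: "oct_conj (((a0, a1), (a2, a3)), ((a4, a5), (a6, a7))) =
  (((a0, -a1), (-a2, -a3)), ((-a4, -a5), (-a6, -a7)))"
  by (simp add: oct_conj_def cd_conj_def)

lemma octB_eq: "octB (((a0, a1), (a2, a3)), ((a4, a5), (a6, a7)))
   (((b0, b1), (b2, b3)), ((b4, b5), (b6, b7))) =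
   a0*b0 + a1*b1 + a2*b2 + a3*b3 + a4*b4 + a5*b5 + a6*b6 + a7*b7"
  by (simp add: octB_def oct_mult_eq oct_conj_eq oct_re_def)

lemma oct_norm_octB: "oct_norm x = octB x x"
  by (simp add: oct_norm_def octB_def)

lemma oct_re_simps [simp]:
  "oct_re (x + y) = oct_re x + oct_re y" "oct_re (x - y) = oct_re x - oct_re y"
  "oct_re (- x) = - oct_re x" "oct_re (c *\<^sub>C x) = c * oct_re x" "oct_re 0 = 0"
  "oct_re (oct_conj x) = oct_re x" "oct_re (oct_of a) = a"
  by (cases x rule: oct_cases, simp add: oct_re_def scaleC_prod_def scaleC_complex_def
      oct_conj_eq oct_of_def)+

lemma oct_conj_simps [simp]:
  "oct_conj (x + y) = oct_conj x + oct_conj y" "oct_conj (x - y) = oct_conj x - oct_conj y"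
  "oct_conj (- x) = - oct_conj x" "oct_conj (c *\<^sub>C x) = c *\<^sub>C oct_conj x" "oct_conj 0 = 0"
  "oct_conj (oct_conj x) = x" "oct_conj (oct_of a) = oct_of a"
  by (cases x rule: oct_cases; cases y rule: oct_cases,
      simp add: scaleC_prod_def scaleC_complex_def oct_conj_def cd_conj_def oct_of_def zero_prod_def)+

lemma oct_of_simps [simp]:
  "oct_of (a + b) = oct_of a + oct_of b" "oct_of 0 = 0" "oct_of (c * a) = c *\<^sub>C oct_of a"
  by (auto simp: oct_of_def scaleC_prod_def scaleC_complex_def zero_prod_def)

lemma oct_mult_oct_of [simp]: "oct_mult (oct_of a) x = a *\<^sub>C x" "oct_mult x (oct_of a) = a *\<^sub>C x"
  by (cases x rule: oct_cases, simp add: oct_of_def zero_prod_def oct_mult_eq scaleC_prod_def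
      scaleC_complex_def mult.commute)+

lemma oct_mult_bilinear [simp]:
  "oct_mult (x + y) z = oct_mult x z + oct_mult y z"
  "oct_mult z (x + y) = oct_mult z x + oct_mult z y"
  "oct_mult (x - y) z = oct_mult x z - oct_mult y z"
  "oct_mult z (x - y) = oct_mult z x - oct_mult z y"
  "oct_mult (- x) z = - oct_mult x z" "oct_mult z (- x) = - oct_mult z x"
  "oct_mult (c *\<^sub>C x) z = c *\<^sub>C oct_mult x z" "oct_mult z (c *\<^sub>C x) = c *\<^sub>C oct_mult z x"
  "oct_mult 0 z = 0" "oct_mult z 0 = 0"
  by (cases x rule: oct_cases; cases y rule: oct_cases; cases z rule: oct_cases,
      simp add: scaleC_prod_def scaleC_complex_def oct_mult_eq zero_prod_def algebra_simps)+

lemma octB_bilinear [simp]: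
  "octB (x + y) z = octB x z + octB y z" "octB z (x + y) = octB z x + octB z y"
  "octB (x - y) z = octB x z - octB y z" "octB z (x - y) = octB z x - octB z y"
  "octB (- x) z = - octB x z" "octB z (- x) = - octB z x"
  "octB (c *\<^sub>C x) z = c * octB x z" "octB z (c *\<^sub>C x) = c * octB z x"
  "octB 0 z = 0" "octB z 0 = 0"
  by (simp_all add: octB_def)

lemma octB_commute: "octB x y = octB y x"
  by (cases x rule: oct_cases; cases y rule: oct_cases) (simp add: octB_eq mult.commute)

lemma octB_conj [simp]: "octB (oct_conj x) (oct_conj y) = octB x y"
  by (cases x rule: oct_cases; cases y rule: oct_cases) (simp add: octB_eq oct_conj_eq)

lemma oct_conj_mult: "oct_conj (oct_mult x y) = oct_mult (oct_conj y) (oct_conj x)"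
  by (cases x rule: oct_cases; cases y rule: oct_cases)
    (simp add: oct_conj_eq oct_mult_eq algebra_simps)

lemma octB_mult_left: "octB (oct_mult x y) z = octB y (oct_mult (oct_conj x) z)"
  by (cases x rule: oct_cases; cases y rule: oct_cases; cases z rule: oct_cases)
    (simp add: oct_conj_eq oct_mult_eq octB_eq algebra_simps)

lemma octB_mult_right: "octB (oct_mult x y) z = octB x (oct_mult z (oct_conj y))"
  using octB_mult_left[of "oct_conj y" "oct_conj x" "oct_conj z"] octB_conj[of "oct_mult x y" z]
    octB_conj[of x "oct_mult z (oct_conj y)"]
  by (simp add: oct_conj_mult)

lemma oct_norm_mult: "octB (oct_mult x y) (oct_mult x y) = octB x x * octB y y"
  by (cases x rule: oct_cases; cases y rule: oct_cases)
    (simp only: oct_mult_eq octB_eq, simp add: algebra_simps)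

lemma octB_nondegenerate:
  assumes "\<And>z. octB x z = octB y z"
  shows "x = y"
  using assms[of "(((1,0),(0,0)),((0,0),(0,0)))"] assms[of "(((0,1),(0,0)),((0,0),(0,0)))"]
    assms[of "(((0,0),(1,0)),((0,0),(0,0)))"] assms[of "(((0,0),(0,1)),((0,0),(0,0)))"]
    assms[of "(((0,0),(0,0)),((1,0),(0,0)))"] assms[of "(((0,0),(0,0)),((0,1),(0,0)))"]
    assms[of "(((0,0),(0,0)),((0,0),(1,0)))"] assms[of "(((0,0),(0,0)),((0,0),(0,1)))"]
  by (cases x rule: oct_cases; cases y rule: oct_cases) (simp add: octB_eq)

lemma oct_re_mult: "oct_re (oct_mult x y) = octB x (oct_conj y)"
  by (simp add: octB_def)

lemma oct_re_mult3: "oct_re (oct_mult (oct_mult z x) y) = octB x (oct_conj (oct_mult y z))"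
  by (simp add: oct_re_mult octB_mult_left oct_conj_mult)

lemma octB_conj_mult_cyclic:
  "octB x (oct_conj (oct_mult y z)) = octB y (oct_conj (oct_mult z x))"
  by (metis oct_conj_mult octB_commute octB_mult_right oct_conj_simps(6) octB_mult_left)

text \<open>The norm is multiplicative; the next two laws are its partial and full polarizations. By
  nondegeneracy of the form they carry all the identities that replace associativity.\<close>

lemma octB_composition: "octB (oct_mult x y) (oct_mult x z) = octB x x * octB y z"
  using oct_norm_mult[of x "y + z"] oct_norm_mult[of x y] oct_norm_mult[of x z]
    octB_commute[of y z] octB_commute[of "oct_mult x y" "oct_mult x z"]
  by (simp add: algebra_simps)

lemma octB_composition2:
  "octB (oct_mult x y) (oct_mult w z) + octB (oct_mult w y) (oct_mult x z) =
    2 * octB x w * octB y z"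
  using octB_composition[of "x + w" y z] octB_composition[of x y z] octB_composition[of w y z]
    octB_commute[of x w]
  by (simp add: algebra_simps)

lemma oct_conj_mult_cancel_left: "oct_mult (oct_conj x) (oct_mult x y) = octB x x *\<^sub>C y"
  by (rule octB_nondegenerate) (simp add: octB_mult_left octB_composition[symmetric])

lemma oct_mult_conj_cancel_right: "oct_mult (oct_mult y x) (oct_conj x) = octB x x *\<^sub>C y"
  using arg_cong[OF oct_conj_mult_cancel_left[of "oct_conj x" "oct_conj y"], of oct_conj]
  by (simp add: oct_conj_mult)

text \<open>The Moufang identity \<open>(xy)(zx) = x(yz)x\<close>, with the right-hand side written out by means
  of the quadratic equation of \<open>x\<close>. Pairing with any \<open>w\<close> reduces it to the polarized composition
  law.\<close>

lemma oct_moufang: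
  "oct_mult (oct_mult x y) (oct_mult z x) =
    (2 * octB x (oct_conj (oct_mult y z))) *\<^sub>C x - octB x x *\<^sub>C oct_conj (oct_mult y z)"
proof (rule octB_nondegenerate)
  fix w
  let ?u = "oct_mult (oct_conj y) (oct_conj x)"
  have "oct_mult ?u x = octB x x *\<^sub>C oct_conj y"
    using oct_mult_conj_cancel_right[of "oct_conj y" "oct_conj x"] by simp
  moreover have "octB z ?u = octB x (oct_conj (oct_mult y z))"
    by (metis octB_mult_left octB_commute octB_conj oct_conj_simps(6))
  moreover have "octB (oct_conj y) (oct_mult z w) = octB (oct_conj (oct_mult y z)) w"
    by (simp add: oct_conj_mult octB_mult_left)
  ultimately show "octB (oct_mult (oct_mult x y) (oct_mult z x)) w =
      octB ((2 * octB x (oct_conj (oct_mult y z))) *\<^sub>C x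
        - octB x x *\<^sub>C oct_conj (oct_mult y z)) w"
    using octB_composition2[of z x ?u w]
    by (simp add: octB_mult_left[of "oct_mult x y"] oct_conj_mult eq_diff_eq)
qed

text \<open>Complex conjugation of the coefficients, as opposed to the conjugation of the algebra, turns
  the bilinear norm form into the Hermitian inner product.\<close>

definition oct_cnj :: "oct \<Rightarrow> oct" where
  "oct_cnj = (\<lambda>(((a, b), (c, d)), ((e, f), (g, h))).
     (((cnj a, cnj b), (cnj c, cnj d)), ((cnj e, cnj f), (cnj g, cnj h))))"

lemma oct_cnj_simps [simp]:
  "oct_cnj (oct_of a) = oct_of (cnj a)" "oct_cnj (oct_conj x) = oct_conj (oct_cnj x)"
  by (cases x rule: oct_cases, simp add: oct_cnj_def oct_of_def oct_conj_eq zero_prod_def)+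

lemma Re_octB_cnj: "Re (octB x (oct_cnj y)) = x \<bullet> y"
  by (cases x rule: oct_cases; cases y rule: oct_cases)
    (simp add: octB_eq oct_cnj_def inner_prod_def inner_complex_def)

lemma oct_inner_simps [simp]:
  "oct_conj x \<bullet> oct_conj y = x \<bullet> y" "oct_of a \<bullet> oct_of b = a \<bullet> b"
  by (cases x rule: oct_cases; cases y rule: oct_cases,
      simp add: inner_prod_def oct_conj_eq oct_of_def)+

text \<open>What the four algebras have in common. Closure under the conjugation of coefficients is a
  real structure, which makes the trace form nondegenerate on the Hermitian matrices over \<open>A\<close>.\<close>

definition cnj_subalgebra :: "oct set \<Rightarrow> bool" where
  "cnj_subalgebra A \<longleftrightarrow> complex_subspace A \<and> range oct_of \<subseteq> A \<and>
     (\<forall>x\<in>A. \<forall>y\<in>A. oct_mult x y \<in> A) \<and> (\<forall>x\<in>A. oct_conj x \<in> A \<and> oct_cnj x \<in> A)"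

lemma cnj_subalgebra_algs:
  assumes "A \<in> {alg_R, alg_C, alg_H, alg_O}"
  shows "cnj_subalgebra A"
proof -
  have "cnj_subalgebra alg_R" "cnj_subalgebra alg_C" "cnj_subalgebra alg_H" "cnj_subalgebra alg_O"
    unfolding cnj_subalgebra_def complex_subspace_def alg_R_def alg_C_def alg_H_def alg_O_def
    by (auto simp: zero_prod_def scaleC_prod_def scaleC_complex_def image_iff oct_mult_eq
        oct_conj_eq oct_cnj_def oct_of_def)
  then show ?thesis using assms by auto
qed

section \<open>Hermitian matrices and the determinant\<close>

text \<open>The off-diagonal coordinates \<open>x\<close>, \<open>y\<close>, \<open>z\<close> are the entries \<open>(2,3)\<close>, \<open>(3,1)\<close>, \<open>(1,2)\<close>: with
  this choice all formulas are symmetric under simultaneous cyclic shifts of \<open>a, b, c\<close> and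
  \<open>x, y, z\<close>.\<close>

definition herm :: "complex \<Rightarrow> complex \<Rightarrow> complex \<Rightarrow> oct \<Rightarrow> oct \<Rightarrow> oct \<Rightarrow> omat" where
  "herm a b c x y z = (\<chi> i j.
     if i = 1 then (if j = 1 then oct_of a else if j = 2 then z else oct_conj y)
     else if i = 2 then (if j = 1 then oct_conj z else if j = 2 then oct_of b else x)
     else (if j = 1 then y else if j = 2 then oct_conj x else oct_of c))"

lemma herm_nth [simp]:
  "herm a b c x y z $ 1 $ 1 = oct_of a" "herm a b c x y z $ 1 $ 2 = z"
  "herm a b c x y z $ 1 $ 3 = oct_conj y" "herm a b c x y z $ 2 $ 1 = oct_conj z"
  "herm a b c x y z $ 2 $ 2 = oct_of b" "herm a b c x y z $ 2 $ 3 = x"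
  "herm a b c x y z $ 3 $ 1 = y" "herm a b c x y z $ 3 $ 2 = oct_conj x"
  "herm a b c x y z $ 3 $ 3 = oct_of c"
  by (simp_all add: herm_def)

lemma omat_eq_iff:
  "(M::omat) = N \<longleftrightarrow> M $ 1 $ 1 = N $ 1 $ 1 \<and> M $ 1 $ 2 = N $ 1 $ 2 \<and> M $ 1 $ 3 = N $ 1 $ 3 \<and>
     M $ 2 $ 1 = N $ 2 $ 1 \<and> M $ 2 $ 2 = N $ 2 $ 2 \<and> M $ 2 $ 3 = N $ 2 $ 3 \<and>
     M $ 3 $ 1 = N $ 3 $ 1 \<and> M $ 3 $ 2 = N $ 3 $ 2 \<and> M $ 3 $ 3 = N $ 3 $ 3"
  by (auto simp: vec_eq_iff forall_3)

lemma J3_herm: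
  assumes "cnj_subalgebra A" "x \<in> A" "y \<in> A" "z \<in> A"
  shows "herm a b c x y z \<in> J3 A"
  using assms by (auto simp: J3_def forall_3 cnj_subalgebra_def)

lemma J3_cases:
  assumes "M \<in> J3 A"
  obtains a b c x y z where "M = herm a b c x y z" "x \<in> A" "y \<in> A" "z \<in> A"
proof -
  have M: "\<forall>i j. M $ i $ j \<in> A" "\<forall>i. M $ i $ i \<in> range oct_of" "\<forall>i j. M $ j $ i = oct_conj (M $ i $ j)"
    using assms unfolding J3_def by blast+
  have off: "M $ 1 $ 3 = oct_conj (M $ 3 $ 1)" "M $ 2 $ 1 = oct_conj (M $ 1 $ 2)"
    "M $ 3 $ 2 = oct_conj (M $ 2 $ 3)"
    using M(3) by blast+
  obtain a b c where "M $ 1 $ 1 = oct_of a" "M $ 2 $ 2 = oct_of b" "M $ 3 $ 3 = oct_of c"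
    using M(2) by blast
  then have "M = herm a b c (M $ 2 $ 3) (M $ 3 $ 1) (M $ 1 $ 2)"
    by (simp add: omat_eq_iff off)
  then show ?thesis using M(1) that by blast
qed

lemma scaleC_vec_nth [simp]: "(c *\<^sub>C v) $ i = c *\<^sub>C (v $ i)"
  by (simp add: scaleC_vec_def)

lemma herm_add: "herm a b c x y z + herm a' b' c' x' y' z' =
    herm (a + a') (b + b') (c + c') (x + x') (y + y') (z + z')"
  by (simp add: omat_eq_iff)

lemma herm_scaleC: "k *\<^sub>C herm a b c x y z =
    herm (k * a) (k * b) (k * c) (k *\<^sub>C x) (k *\<^sub>C y) (k *\<^sub>C z)"
  by (simp add: omat_eq_iff)

lemma herm_zero: "herm 0 0 0 0 0 0 = 0"
  by (simp add: omat_eq_iff)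

lemma omat_one_herm: "omat_one = herm 1 1 1 0 0 0"
  by (simp add: omat_eq_iff omat_one_def)

lemma complex_subspace_J3: "cnj_subalgebra A \<Longrightarrow> complex_subspace (J3 A)"
proof -
  assume A: "cnj_subalgebra A"
  then have V: "complex_subspace A" by (simp add: cnj_subalgebra_def)
  show ?thesis
    unfolding complex_subspace_def
  proof (intro conjI ballI allI)
    show "0 \<in> J3 A"
      unfolding herm_zero[symmetric] by (intro J3_herm[OF A] csubspace_zero[OF V])
  next
    fix M N assume "M \<in> J3 A" "N \<in> J3 A"
    then show "M + N \<in> J3 A"
      by (elim J3_cases) (simp only: herm_add J3_herm[OF A] csubspace_add[OF V])
  next
    fix c M assume "M \<in> J3 A"
    then show "c *\<^sub>C M \<in> J3 A"
      by (elim J3_cases) (simp only: herm_scaleC J3_herm[OF A] csubspace_scaleC[OF V])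
  qed
qed

lemma trace_form_herm: "trace_form (herm a b c x y z) (herm a' b' c' x' y' z') =
    a * a' + b * b' + c * c' + 2 * (octB x x' + octB y y' + octB z z')"
  by (simp add: trace_form_def jordan_def omat_mult_def sum_3 oct_re_mult octB_commute algebra_simps)

lemma jdet_herm: "jdet (herm a b c x y z) = a * b * c - a * octB x x - b * octB y y - c * octB z z
    + 2 * octB x (oct_conj (oct_mult y z))"
  by (simp add: jdet_def oct_norm_octB oct_re_mult3)

text \<open>The determinant is a sum of three kinds of cubics, \<open>abc\<close>, \<open>a n(x)\<close> and the trilinear trace of
  \<open>x\<close>, \<open>y\<close>, \<open>z\<close>, which are polarized separately.\<close>

lemma jdet_polar_herm:
  "6 * jdet_polar (herm a b c x y z) (herm a' b' c' x' y' z') (herm a'' b'' c'' x'' y'' z'') =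
    a * b' * c'' + a * b'' * c' + a' * b * c'' + a' * b'' * c + a'' * b * c' + a'' * b' * c
    - 2 * (a * octB x' x'' + a' * octB x x'' + a'' * octB x x')
    - 2 * (b * octB y' y'' + b' * octB y y'' + b'' * octB y y')
    - 2 * (c * octB z' z'' + c' * octB z z'' + c'' * octB z z')
    + 2 * octB x (oct_conj (oct_mult y' z'' + oct_mult y'' z'))
    + 2 * octB x' (oct_conj (oct_mult y z'' + oct_mult y'' z))
    + 2 * octB x'' (oct_conj (oct_mult y z' + oct_mult y' z))"
proof -
  have six: "6 * jdet_polar r s t = jdet (r + s + t) - jdet (r + s) - jdet (s + t) - jdet (r + t)
      + jdet r + jdet s + jdet t" for r s t
    by (simp add: jdet_polar_def)
  have q: "(a + a' + a'') * octB (x + x' + x'') (x + x' + x'') - (a + a') * octB (x + x') (x + x')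
      - (a' + a'') * octB (x' + x'') (x' + x'') - (a + a'') * octB (x + x'') (x + x'')
      + a * octB x x + a' * octB x' x' + a'' * octB x'' x'' =
      2 * (a * octB x' x'' + a' * octB x x'' + a'' * octB x x')" for a a' a'' x x' x''
    using octB_commute[of x' x] octB_commute[of x'' x] octB_commute[of x'' x']
    by (simp add: algebra_simps)
  let ?T = "\<lambda>x y z. octB x (oct_conj (oct_mult y z))"
  have T: "?T (x + x' + x'') (y + y' + y'') (z + z' + z'') - ?T (x + x') (y + y') (z + z')
      - ?T (x' + x'') (y' + y'') (z' + z'') - ?T (x + x'') (y + y'') (z + z'')
      + ?T x y z + ?T x' y' z' + ?T x'' y'' z'' =
     octB x (oct_conj (oct_mult y' z'' + oct_mult y'' z'))
    + octB x' (oct_conj (oct_mult y z'' + oct_mult y'' z))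
    + octB x'' (oct_conj (oct_mult y z' + oct_mult y' z))"
    by (simp add: algebra_simps)
  have "6 * jdet_polar (herm a b c x y z) (herm a' b' c' x' y' z') (herm a'' b'' c'' x'' y'' z'') =
    a * b' * c'' + a * b'' * c' + a' * b * c'' + a' * b'' * c + a'' * b * c' + a'' * b' * c
    - ((a + a' + a'') * octB (x + x' + x'') (x + x' + x'') - (a + a') * octB (x + x') (x + x')
      - (a' + a'') * octB (x' + x'') (x' + x'') - (a + a'') * octB (x + x'') (x + x'')
      + a * octB x x + a' * octB x' x' + a'' * octB x'' x'')
    - ((b + b' + b'') * octB (y + y' + y'') (y + y' + y'') - (b + b') * octB (y + y') (y + y')
      - (b' + b'') * octB (y' + y'') (y' + y'') - (b + b'') * octB (y + y'') (y + y'')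
      + b * octB y y + b' * octB y' y' + b'' * octB y'' y'')
    - ((c + c' + c'') * octB (z + z' + z'') (z + z' + z'') - (c + c') * octB (z + z') (z + z')
      - (c' + c'') * octB (z' + z'') (z' + z'') - (c + c'') * octB (z + z'') (z + z'')
      + c * octB z z + c' * octB z' z' + c'' * octB z'' z'')
    + 2 * (?T (x + x' + x'') (y + y' + y'') (z + z' + z'') - ?T (x + x') (y + y') (z + z')
      - ?T (x' + x'') (y' + y'') (z' + z'') - ?T (x + x'') (y + y'') (z + z'')
      + ?T x y z + ?T x' y' z' + ?T x'' y'' z'')"
    unfolding six herm_add jdet_herm by algebra
  then show ?thesis unfolding q T by (simp add: algebra_simps)
qed

text \<open>Freudenthal's adjoint, the gradient of the determinant with respect to the trace form.\<close>

definition jadj :: "omat \<Rightarrow> omat" where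
  "jadj M = (let a = oct_re (M $ 1 $ 1); b = oct_re (M $ 2 $ 2); c = oct_re (M $ 3 $ 3);
     x = M $ 2 $ 3; y = M $ 3 $ 1; z = M $ 1 $ 2 in
   herm (b * c - octB x x) (c * a - octB y y) (a * b - octB z z)
     (oct_conj (oct_mult y z) - a *\<^sub>C x) (oct_conj (oct_mult z x) - b *\<^sub>C y)
     (oct_conj (oct_mult x y) - c *\<^sub>C z))"

lemma jadj_herm: "jadj (herm a b c x y z) =
   herm (b * c - octB x x) (c * a - octB y y) (a * b - octB z z)
     (oct_conj (oct_mult y z) - a *\<^sub>C x) (oct_conj (oct_mult z x) - b *\<^sub>C y)
     (oct_conj (oct_mult x y) - c *\<^sub>C z)"
  by (simp add: jadj_def)

lemma J3_jadj:
  assumes "cnj_subalgebra A" "M \<in> J3 A"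
  shows "jadj M \<in> J3 A"
proof -
  obtain a b c x y z where M: "M = herm a b c x y z" "x \<in> A" "y \<in> A" "z \<in> A"
    using J3_cases[OF assms(2)] .
  have V: "complex_subspace A" using assms by (simp add: cnj_subalgebra_def)
  show ?thesis
    unfolding M(1) jadj_herm using assms(1) M(2-)
    by (intro J3_herm[OF assms(1)] csubspace_diff[OF V] csubspace_scaleC[OF V])
      (auto simp: cnj_subalgebra_def)
qed

lemma trace_form_jadj:
  assumes "r \<in> J3 A" "t \<in> J3 A"
  shows "trace_form t (jadj r) = 3 * jdet_polar r r t"
proof -
  obtain a b c x y z where r: "r = herm a b c x y z" using J3_cases[OF assms(1)] .
  obtain a' b' c' x' y' z' where t: "t = herm a' b' c' x' y' z'" using J3_cases[OF assms(2)] .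
  have cyc: "octB x (oct_conj (oct_mult y' z)) = octB y' (oct_conj (oct_mult z x))"
    "octB x (oct_conj (oct_mult y z')) = octB z' (oct_conj (oct_mult x y))"
    by (metis octB_conj_mult_cyclic)+
  have "2 * trace_form t (jadj r) = 6 * jdet_polar r r t"
    unfolding r t jadj_herm trace_form_herm jdet_polar_herm
    by (simp add: cyc octB_commute algebra_simps)
  then show ?thesis by simp
qed

text \<open>The diagonal entries come down to multiplicativity of the norm. In the off-diagonal ones the
  product of \<open>conj(zx)\<close> and \<open>conj(xy)\<close> appears, which the Moufang identity evaluates.\<close>

lemma jadj_jadj:
  assumes "r \<in> J3 A"
  shows "jadj (jadj r) = jdet r *\<^sub>C r"
proof -
  obtain a b c x y z where r: "r = herm a b c x y z" using J3_cases[OF assms(1)] .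
  have off: "oct_conj (oct_mult (oct_conj (oct_mult z x) - b *\<^sub>C y) (oct_conj (oct_mult x y) - c *\<^sub>C z))
     - (b * c - octB x x) *\<^sub>C (oct_conj (oct_mult y z) - a *\<^sub>C x)
     = (a * b * c - a * octB x x - b * octB y y - c * octB z z
        + 2 * octB x (oct_conj (oct_mult y z))) *\<^sub>C x" for a b c x y z
  proof -
    have "oct_conj (oct_mult (oct_conj (oct_mult z x) - b *\<^sub>C y) (oct_conj (oct_mult x y) - c *\<^sub>C z))
      = oct_mult (oct_mult x y) (oct_mult z x) - c *\<^sub>C oct_mult (oct_conj z) (oct_mult z x)
        - b *\<^sub>C oct_mult (oct_mult x y) (oct_conj y) + (b * c) *\<^sub>C oct_conj (oct_mult y z)"
      by (simp add: oct_conj_mult scaleC_diff_right scaleC_scaleC mult.commute[of c b])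
    also have "\<dots> = (2 * octB x (oct_conj (oct_mult y z))) *\<^sub>C x - octB x x *\<^sub>C oct_conj (oct_mult y z)
        - (c * octB z z) *\<^sub>C x - (b * octB y y) *\<^sub>C x + (b * c) *\<^sub>C oct_conj (oct_mult y z)"
      by (simp only: oct_moufang oct_conj_mult_cancel_left oct_mult_conj_cancel_right scaleC_scaleC)
    finally show ?thesis
      by (simp del: oct_conj_simps octB_bilinear add: scaleC_diff_left scaleC_diff_right scaleC_add_left
          scaleC_scaleC algebra_simps)
  qed
  have diag: "(c * a - octB y y) * (a * b - octB z z)
      - octB (oct_conj (oct_mult y z) - a *\<^sub>C x) (oct_conj (oct_mult y z) - a *\<^sub>C x)
     = (a * b * c - a * octB x x - b * octB y y - c * octB z z
        + 2 * octB x (oct_conj (oct_mult y z))) * a" for a b c x y z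
    by (simp add: oct_norm_mult octB_commute algebra_simps)
  have cyc: "octB y (oct_conj (oct_mult z x)) = octB x (oct_conj (oct_mult y z))"
     "octB z (oct_conj (oct_mult x y)) = octB x (oct_conj (oct_mult y z))"
    by (metis octB_conj_mult_cyclic)+
  show ?thesis
    unfolding r jadj_herm jdet_herm herm_scaleC off diag cyc
    by (simp only: algebra_simps)
qed

lemma jdet_omat_one: "jdet omat_one = 1"
  by (simp add: omat_one_herm jdet_herm)

lemma jadj_omat_one: "jadj omat_one = omat_one"
  by (simp add: omat_one_herm jadj_herm)

lemma trace_form_omat_one: "trace_form omat_one omat_one = 3"
  by (simp add: omat_one_herm trace_form_herm)

lemma J3_omat_one: "cnj_subalgebra A \<Longrightarrow> omat_one \<in> J3 A"
  unfolding omat_one_herm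
  by (rule J3_herm) (auto simp: cnj_subalgebra_def complex_subspace_def)

lemma trace_form_commute: "trace_form M N = trace_form N M"
  by (simp add: trace_form_def jordan_def add.commute)

lemma trace_form_clinear:
  assumes "s \<in> J3 A"
  shows "clinear_on (J3 A) UNIV (\<lambda>r. trace_form r s)"
proof -
  obtain a b c x y z where s: "s = herm a b c x y z" using J3_cases[OF assms] .
  show ?thesis
  proof (rule clinear_onI)
    fix r t assume "r \<in> J3 A" "t \<in> J3 A"
    then show "trace_form (r + t) s = trace_form r s + trace_form t s"
      by (elim J3_cases) (simp add: s herm_add trace_form_herm algebra_simps)
  next
    fix k r assume "r \<in> J3 A"
    then show "trace_form (k *\<^sub>C r) s = k *\<^sub>C trace_form r s"
      by (elim J3_cases) (simp add: s herm_scaleC trace_form_herm scaleC_complex_def algebra_simps)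
  qed simp
qed

lemma jdet_polar_commute:
  "jdet_polar r s t = jdet_polar s r t" "jdet_polar r s t = jdet_polar r t s"
  by (simp_all add: jdet_polar_def add_ac)

text \<open>The polarized determinant is the pairing of one argument with a bilinear expression in the
  other two, the polarized adjoint; its linearity follows from this.\<close>

lemma jdet_polar_trace_form:
  "6 * jdet_polar (herm a b c x y z) (herm a' b' c' x' y' z') (herm a'' b'' c'' x'' y'' z'') =
   trace_form (herm a b c x y z) (herm (b' * c'' + b'' * c' - 2 * octB x' x'')
     (a' * c'' + a'' * c' - 2 * octB y' y'') (a' * b'' + a'' * b' - 2 * octB z' z'')
     (oct_conj (oct_mult y' z'' + oct_mult y'' z') - a' *\<^sub>C x'' - a'' *\<^sub>C x')
     (oct_conj (oct_mult z' x'' + oct_mult z'' x') - b' *\<^sub>C y'' - b'' *\<^sub>C y')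
     (oct_conj (oct_mult x' y'' + oct_mult x'' y') - c' *\<^sub>C z'' - c'' *\<^sub>C z'))"
proof -
  have cyc: "octB x' (oct_conj (oct_mult y z'')) = octB y (oct_conj (oct_mult z'' x'))"
    "octB x' (oct_conj (oct_mult y'' z)) = octB z (oct_conj (oct_mult x' y''))"
    "octB x'' (oct_conj (oct_mult y z')) = octB y (oct_conj (oct_mult z' x''))"
    "octB x'' (oct_conj (oct_mult y' z)) = octB z (oct_conj (oct_mult x'' y'))"
    by (metis octB_conj_mult_cyclic)+
  show ?thesis
    unfolding jdet_polar_herm trace_form_herm octB_bilinear oct_conj_simps cyc
    by algebra
qed

lemma jdet_polar_clinear:
  assumes A: "cnj_subalgebra A" and "s \<in> J3 A" "t \<in> J3 A"
  shows "clinear_on (J3 A) UNIV (\<lambda>r. jdet_polar r s t)"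
proof -
  have V: "complex_subspace A" using A by (simp add: cnj_subalgebra_def)
  obtain a b c x y z where s: "s = herm a b c x y z" "x \<in> A" "y \<in> A" "z \<in> A"
    using J3_cases[OF assms(2)] .
  obtain a' b' c' x' y' z' where t: "t = herm a' b' c' x' y' z'" "x' \<in> A" "y' \<in> A" "z' \<in> A"
    using J3_cases[OF assms(3)] .
  define u where "u = herm (b * c' + b' * c - 2 * octB x x')
     (a * c' + a' * c - 2 * octB y y') (a * b' + a' * b - 2 * octB z z')
     (oct_conj (oct_mult y z' + oct_mult y' z) - a *\<^sub>C x' - a' *\<^sub>C x)
     (oct_conj (oct_mult z x' + oct_mult z' x) - b *\<^sub>C y' - b' *\<^sub>C y)
     (oct_conj (oct_mult x y' + oct_mult x' y) - c *\<^sub>C z' - c' *\<^sub>C z)"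
  have u: "u \<in> J3 A"
    unfolding u_def using A s(2-) t(2-)
    by (intro J3_herm[OF A] csubspace_diff[OF V] csubspace_scaleC[OF V])
      (auto simp: cnj_subalgebra_def simp del: oct_conj_simps intro!: csubspace_add[OF V])
  have eq: "jdet_polar r s t = trace_form r u / 6" if r: "r \<in> J3 A" for r
  proof -
    obtain a'' b'' c'' x'' y'' z'' where r: "r = herm a'' b'' c'' x'' y'' z''"
      using J3_cases[OF r] .
    have "6 * jdet_polar r s t = trace_form r u"
      unfolding r s(1) t(1) u_def by (rule jdet_polar_trace_form)
    then show ?thesis by (metis nonzero_mult_div_cancel_left zero_neq_numeral)
  qed
  note lin = trace_form_clinear[OF u] and W = complex_subspace_J3[OF A]
  show ?thesis
    by (rule clinear_onI)
      (simp_all add: eq csubspace_add[OF W] csubspace_scaleC[OF W] clinear_on_add[OF lin]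
        clinear_on_scaleC[OF lin] scaleC_complex_def add_divide_distrib)
qed

lemma jdet_polar_diag:
  assumes "r \<in> J3 A"
  shows "jdet_polar r r r = jdet r"
proof -
  obtain a b c x y z where r: "r = herm a b c x y z" using J3_cases[OF assms] .
  have "6 * jdet_polar r r r = 6 * jdet r"
    unfolding r jdet_polar_herm jdet_herm by (simp add: algebra_simps)
  then show ?thesis by simp
qed

definition omat_cnj :: "omat \<Rightarrow> omat" where
  "omat_cnj M = (\<chi> i j. oct_cnj (M $ i $ j))"

lemma omat_cnj_herm: "omat_cnj (herm a b c x y z) =
    herm (cnj a) (cnj b) (cnj c) (oct_cnj x) (oct_cnj y) (oct_cnj z)"
  by (simp add: omat_eq_iff omat_cnj_def)

lemma J3_omat_cnj:
  assumes "cnj_subalgebra A" "M \<in> J3 A"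
  shows "omat_cnj M \<in> J3 A"
  using J3_cases[OF assms(2)] assms(1)
  by (metis J3_herm omat_cnj_herm cnj_subalgebra_def)

lemma Re_trace_form_cnj:
  assumes "M \<in> J3 A" "N \<in> J3 A"
  shows "Re (trace_form M (omat_cnj N)) = M \<bullet> N"
proof -
  obtain a b c x y z where M: "M = herm a b c x y z" using J3_cases[OF assms(1)] .
  obtain a' b' c' x' y' z' where N: "N = herm a' b' c' x' y' z'" using J3_cases[OF assms(2)] .
  have "Re (p * cnj q) = p \<bullet> q" for p q by (simp add: inner_complex_def)
  moreover have "Re (2 * p) = 2 * Re p" for p by simp
  ultimately have "Re (trace_form M (omat_cnj N)) =
      a \<bullet> a' + b \<bullet> b' + c \<bullet> c' + 2 * (x \<bullet> x' + y \<bullet> y' + z \<bullet> z')"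
    unfolding M N omat_cnj_herm trace_form_herm plus_complex.sel
    by (simp add: Re_octB_cnj del: times_complex.sel complex_cnj)
  then show ?thesis
    by (simp add: M N inner_vec_def sum_3)
qed

lemma trace_form_nondegenerate:
  assumes A: "cnj_subalgebra A" and uv: "u \<in> J3 A" "v \<in> J3 A"
    and eq: "\<And>t. t \<in> J3 A \<Longrightarrow> trace_form t u = trace_form t v"
  shows "u = v"
proof -
  note V = complex_subspace_J3[OF A]
  define d where "d = u - v"
  have d: "d \<in> J3 A" unfolding d_def using V uv by (intro csubspace_diff)
  have cd: "omat_cnj d \<in> J3 A" by (rule J3_omat_cnj[OF A d])
  have "trace_form d (omat_cnj d) = trace_form u (omat_cnj d) - trace_form v (omat_cnj d)"
    unfolding d_def[of] using clinear_on_diff[OF trace_form_clinear[OF cd] V uv] by (simp add: d_def)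
  also have "\<dots> = 0" using eq[OF cd] by (simp add: trace_form_commute)
  finally have "d \<bullet> d = 0" using Re_trace_form_cnj[OF d d] by simp
  then show ?thesis by (simp add: d_def)
qed

text \<open>The trace form identifies \<open>J3 A\<close> with its dual: composed with complex conjugation in one
  argument, its real part is the Euclidean inner product, for which functionals are represented by
  the orthogonal projections of their gradients.\<close>

lemma trace_form_riesz:
  assumes A: "cnj_subalgebra A" and f: "clinear_on (J3 A) UNIV f"
  obtains u where "u \<in> J3 A" "\<And>t. t \<in> J3 A \<Longrightarrow> trace_form t u = f t"
proof -
  note V = complex_subspace_J3[OF A]
  obtain F where F: "linear F" "\<And>t. t \<in> J3 A \<Longrightarrow> F t = f t"
    using linear_extension[OF V f] by metis
  have lin: "linear (\<lambda>t. Re (F t))"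
    using linear_compose[OF F(1) bounded_linear.linear[OF bounded_linear_Re]] by (simp add: o_def)
  define y where "y = adjoint (\<lambda>t. Re (F t)) 1"
  have y: "Re (F t) = t \<bullet> y" for t
    using adjoint_works[OF lin, of t 1] by (simp add: y_def)
  obtain z o' where z: "z \<in> span (J3 A)" "\<And>t. t \<in> span (J3 A) \<Longrightarrow> orthogonal o' t" "y = z + o'"
    using orthogonal_subspace_decomp_exists[of "J3 A" y] by metis
  have span: "span (J3 A) = J3 A" using csubspace_subspace[OF V] by (simp add: span_eq_iff)
  let ?u = "omat_cnj z"
  have u: "?u \<in> J3 A" using J3_omat_cnj[OF A] z(1) span by simp
  have Re: "Re (trace_form t ?u) = Re (f t)" if "t \<in> J3 A" for t
  proof -
    have "t \<bullet> o' = 0" using z(2)[of t] that span by (simp add: orthogonal_def inner_commute)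
    then have "Re (F t) = t \<bullet> z" using y[of t] z(3) by (simp add: inner_right_distrib)
    then show ?thesis
      using Re_trace_form_cnj[OF that, of z] z(1) span F(2)[OF that] by simp
  qed
  have "trace_form t ?u = f t" if t: "t \<in> J3 A" for t
  proof (rule complex_eqI)
    have "\<i> *\<^sub>C t \<in> J3 A" using V t by (rule csubspace_scaleC)
    from Re[OF this] show "Im (trace_form t ?u) = Im (f t)"
      by (simp add: clinear_on_scaleC[OF trace_form_clinear[OF u] t] clinear_on_scaleC[OF f t]
          scaleC_complex_def)
  qed (rule Re[OF t])
  then show ?thesis using u that by blast
qed

text \<open>Contractions and dual actions are defined as the elements that represent given forms; these
  definite descriptions therefore denote.\<close>

lemma the_riesz:
  assumes A: "cnj_subalgebra A" and f: "clinear_on (J3 A) UNIV f"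
  defines "u \<equiv> (THE u. u \<in> J3 A \<and> (\<forall>t\<in>J3 A. trace_form t u = f t))"
  shows "u \<in> J3 A" "t \<in> J3 A \<Longrightarrow> trace_form t u = f t"
proof -
  have "\<exists>!u. u \<in> J3 A \<and> (\<forall>t\<in>J3 A. trace_form t u = f t)"
    using trace_form_riesz[OF A f] trace_form_nondegenerate[OF A] by (smt (verit))
  from theI'[OF this] show "u \<in> J3 A" "t \<in> J3 A \<Longrightarrow> trace_form t u = f t"
    unfolding u_def by auto
qed

section \<open>Contractions and dual actions\<close>

lemma trace_form_bilinear:
  assumes A: "cnj_subalgebra A"
  shows "r \<in> J3 A \<Longrightarrow> s \<in> J3 A \<Longrightarrow> t \<in> J3 A \<Longrightarrow> trace_form (r + s) t = trace_form r t + trace_form s t"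
    "r \<in> J3 A \<Longrightarrow> s \<in> J3 A \<Longrightarrow> t \<in> J3 A \<Longrightarrow> trace_form t (r + s) = trace_form t r + trace_form t s"
    "r \<in> J3 A \<Longrightarrow> t \<in> J3 A \<Longrightarrow> trace_form (c *\<^sub>C r) t = c * trace_form r t"
    "r \<in> J3 A \<Longrightarrow> t \<in> J3 A \<Longrightarrow> trace_form t (c *\<^sub>C r) = c * trace_form t r"
  using clinear_on_add[OF trace_form_clinear[of t A]] clinear_on_scaleC[OF trace_form_clinear[of t A]]
  by (simp_all add: trace_form_commute[of t] scaleC_complex_def)

lemma
  assumes A: "cnj_subalgebra A" and T: "symmetric_trilinear_on (J3 A) T"
    and rs: "r \<in> J3 A" "s \<in> J3 A"
  shows contract_mem: "contract A T r s \<in> J3 A"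
    and trace_form_contract_aux: "t \<in> J3 A \<Longrightarrow> trace_form t (contract A T r s) = T r s t"
proof -
  have "clinear_on (J3 A) UNIV (\<lambda>t. T t r s)"
    using T rs by (simp add: symmetric_trilinear_on_def)
  moreover have "T t r s = T r s t" if "t \<in> J3 A" for t
  proof -
    have "T t r s = T r t s" "T r t s = T r s t"
      using T rs that unfolding symmetric_trilinear_on_def by blast+
    then show ?thesis by simp
  qed
  ultimately have f: "clinear_on (J3 A) UNIV (\<lambda>t. T r s t)"
    using complex_subspace_J3[OF A] unfolding clinear_on_def
    by (auto simp: csubspace_add csubspace_scaleC)
  show "contract A T r s \<in> J3 A"
    and "t \<in> J3 A \<Longrightarrow> trace_form t (contract A T r s) = T r s t"
    unfolding contract_def using the_riesz[OF A f] by auto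
qed

lemma
  assumes A: "cnj_subalgebra A" and X: "clinear_on (J3 A) (J3 A) X"
  shows dual_lie_mem: "s \<in> J3 A \<Longrightarrow> dual_lie_act A X s \<in> J3 A"
    and trace_form_dual_lie: "s \<in> J3 A \<Longrightarrow> r \<in> J3 A \<Longrightarrow>
      trace_form r (dual_lie_act A X s) = - trace_form (X r) s"
    and dual_lie_clinear: "clinear_on (J3 A) (J3 A) (dual_lie_act A X)"
proof -
  note V = complex_subspace_J3[OF A]
  have f: "clinear_on (J3 A) UNIV (\<lambda>r. - trace_form (X r) s)" if s: "s \<in> J3 A" for s
    by (rule clinear_onI)
      (simp_all add: clinear_on_add[OF X] clinear_on_scaleC[OF X] clinear_on_mem[OF X]
        clinear_on_add[OF trace_form_clinear[OF s]] clinear_on_scaleC[OF trace_form_clinear[OF s]]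
        scaleC_complex_def)
  show mem: "dual_lie_act A X s \<in> J3 A"
    and tr: "r \<in> J3 A \<Longrightarrow> trace_form r (dual_lie_act A X s) = - trace_form (X r) s"
    if "s \<in> J3 A" for r s
    unfolding dual_lie_act_def using the_riesz[OF A f[OF that]] by auto
  have lin: "clinear_on (J3 A) UNIV (trace_form r)" if "r \<in> J3 A" for r
  proof -
    have "trace_form r = (\<lambda>s. trace_form s r)" by (rule ext) (rule trace_form_commute)
    then show ?thesis using trace_form_clinear[OF that] by simp
  qed
  show "clinear_on (J3 A) (J3 A) (dual_lie_act A X)"
  proof (rule clinear_onI[OF mem])
    fix s t assume st: "s \<in> J3 A" "t \<in> J3 A"
    show "dual_lie_act A X (s + t) = dual_lie_act A X s + dual_lie_act A X t"
      by (rule trace_form_nondegenerate[OF A])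
        (simp_all add: tr mem st csubspace_add[OF V] clinear_on_add[OF lin] clinear_on_mem[OF X])
  next
    fix c s assume s: "s \<in> J3 A"
    show "dual_lie_act A X (c *\<^sub>C s) = c *\<^sub>C dual_lie_act A X s"
      by (rule trace_form_nondegenerate[OF A])
        (simp_all add: tr mem s csubspace_scaleC[OF V] clinear_on_scaleC[OF lin]
          clinear_on_mem[OF X] scaleC_complex_def)
  qed
qed

lemma polynomial_on_cong:
  assumes V: "complex_subspace V" and P: "polynomial_on V P" and eq: "\<And>v. v \<in> V \<Longrightarrow> P v = R v"
  shows "polynomial_on V R"
proof -
  \<comment> \<open>The difference vanishes on \<open>V\<close>, so that it counts as a linear form there.\<close>
  have "clinear_on V UNIV (\<lambda>v. R v - P v)"
    by (rule clinear_onI) (simp_all add: eq csubspace_add[OF V] csubspace_scaleC[OF V])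
  from poly_add[OF P poly_linear[OF this]] show ?thesis by simp
qed

text \<open>Polynomial maps into \<open>J3 A\<close> are those whose coordinates, that is, whose compositions with
  linear forms, are polynomials. Since coordinate forms are pairings with fixed elements, the
  pairing and the contractions preserve them.\<close>

definition polynomial_map :: "oct set \<Rightarrow> 'a::complex_space set \<Rightarrow> ('a \<Rightarrow> omat) \<Rightarrow> bool" where
  "polynomial_map A Z \<phi> \<longleftrightarrow> \<phi> ` Z \<subseteq> J3 A \<and>
     (\<forall>l. clinear_on (J3 A) UNIV l \<longrightarrow> polynomial_on Z (\<lambda>w. l (\<phi> w)))"

lemma polynomial_map_mem: "polynomial_map A Z \<phi> \<Longrightarrow> w \<in> Z \<Longrightarrow> \<phi> w \<in> J3 A"
  by (auto simp: polynomial_map_def)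

lemma polynomial_map_linear:
  assumes "clinear_on Z (J3 A) \<phi>" shows "polynomial_map A Z \<phi>"
  unfolding polynomial_map_def
proof (intro conjI allI impI)
  show "\<phi> ` Z \<subseteq> J3 A" using assms by (simp add: clinear_on_def)
  show "polynomial_on Z (\<lambda>w. l (\<phi> w))" if "clinear_on (J3 A) UNIV l" for l
    by (rule poly_linear[OF clinear_on_comp[OF assms that]])
qed

lemma polynomial_map_form:
  "polynomial_map A Z \<phi> \<Longrightarrow> clinear_on (J3 A) UNIV l \<Longrightarrow> polynomial_on Z (\<lambda>w. l (\<phi> w))"
  by (simp add: polynomial_map_def)

definition entry_coeff :: "nat \<Rightarrow> oct \<Rightarrow> complex" where
  "entry_coeff k x = (case x of (((a, b), (c, d)), ((e, f), (g, h))) \<Rightarrow> [a, b, c, d, e, f, g, h] ! k)"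

lemma entry_coeff_linear: 
  "k < 8 \<Longrightarrow> entry_coeff k (x + y) = entry_coeff k x + entry_coeff k y"
  "k < 8 \<Longrightarrow> entry_coeff k (c *\<^sub>C x) = c * entry_coeff k x"
  unfolding less_Suc_eq numeral_eq_Suc pred_numeral_simps
  by (cases x rule: oct_cases; cases y rule: oct_cases;
      auto simp: entry_coeff_def scaleC_prod_def scaleC_complex_def numeral_eq_Suc less_Suc_eq)+

lemma octB_entry_coeff: "octB x y = (\<Sum>k<8. entry_coeff k x * entry_coeff k y)"
  by (cases x rule: oct_cases; cases y rule: oct_cases)
    (simp add: octB_eq entry_coeff_def eval_nat_numeral lessThan_Suc)

text \<open>In coordinates the trace form is the standard bilinear form on the entries, so that the
  pairing of two polynomial maps is a sum of products of coordinates.\<close>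

lemma trace_form_entries:
  assumes "M \<in> J3 A" "N \<in> J3 A"
  shows "trace_form M N = (\<Sum>i\<in>UNIV. \<Sum>j\<in>UNIV. octB (M $ i $ j) (N $ i $ j))"
proof -
  obtain a b c x y z where M: "M = herm a b c x y z" using J3_cases[OF assms(1)] .
  obtain a' b' c' x' y' z' where N: "N = herm a' b' c' x' y' z'" using J3_cases[OF assms(2)] .
  have "octB (oct_of p) (oct_of q) = p * q" for p q
    by (simp add: octB_def)
  then show ?thesis by (simp add: M N trace_form_herm sum_3)
qed

lemma polynomial_map_pairing:
  assumes A: "cnj_subalgebra A" and Z: "complex_subspace Z"
    and pm: "polynomial_map A Z \<phi>" "polynomial_map A Z \<psi>"
  shows "polynomial_on Z (\<lambda>w. trace_form (\<phi> w) (\<psi> w))"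
proof (rule polynomial_on_cong[OF Z])
  have l: "clinear_on (J3 A) UNIV (\<lambda>M. entry_coeff k (M $ i $ j))" if "k < 8" for k i j
    by (rule clinear_onI) (simp_all add: entry_coeff_linear[OF that] scaleC_complex_def)
  show "polynomial_on Z (\<lambda>w. \<Sum>i\<in>UNIV. \<Sum>j\<in>UNIV. \<Sum>k<8.
      entry_coeff k (\<phi> w $ i $ j) * entry_coeff k (\<psi> w $ i $ j))"
    by (intro polynomial_on_sum poly_mult polynomial_map_form[OF pm(1) l]
        polynomial_map_form[OF pm(2) l]) auto
  show "(\<Sum>i\<in>UNIV. \<Sum>j\<in>UNIV. \<Sum>k<8. entry_coeff k (\<phi> w $ i $ j) * entry_coeff k (\<psi> w $ i $ j)) =
      trace_form (\<phi> w) (\<psi> w)" if "w \<in> Z" for w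
    using trace_form_entries[OF polynomial_map_mem[OF pm(1) that] polynomial_map_mem[OF pm(2) that]]
    by (simp add: octB_entry_coeff)
qed

section \<open>Symmetric trilinear forms\<close>

locale cubic_form =
  fixes A :: "oct set" and T :: trilinear
  assumes A: "cnj_subalgebra A" and T: "symmetric_trilinear_on (J3 A) T"
begin

lemmas V = complex_subspace_J3[OF A]

lemmas mem = csubspace_zero[OF V] csubspace_add[OF V] csubspace_diff[OF V] csubspace_minus[OF V]
  csubspace_scaleC[OF V] csubspace_scaleR[OF V] contract_mem[OF A T]

lemma commute:
  assumes "r \<in> J3 A" "s \<in> J3 A" "t \<in> J3 A"
  shows "T r s t = T s r t" "T r s t = T r t s" "T r s t = T t s r"
proof -
  have 1: "T x y z = T y x z" "T x y z = T x z y" if "x \<in> J3 A" "y \<in> J3 A" "z \<in> J3 A" for x y z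
    using T that unfolding symmetric_trilinear_on_def by blast+
  then show "T r s t = T s r t" "T r s t = T r t s" using assms by blast+
  show "T r s t = T t s r"
    using 1(1)[OF assms] 1(2)[OF assms(2,1,3)] 1(1)[OF assms(2,3,1)] by simp
qed

lemma linear1: "s \<in> J3 A \<Longrightarrow> t \<in> J3 A \<Longrightarrow> clinear_on (J3 A) UNIV (\<lambda>r. T r s t)"
  using T unfolding symmetric_trilinear_on_def by blast

lemma linear2: "r \<in> J3 A \<Longrightarrow> t \<in> J3 A \<Longrightarrow> clinear_on (J3 A) UNIV (\<lambda>s. T r s t)"
  using linear1[of r t] commute(1)[of r _ t] unfolding clinear_on_def by (simp add: mem)

lemma linear3: "r \<in> J3 A \<Longrightarrow> s \<in> J3 A \<Longrightarrow> clinear_on (J3 A) UNIV (\<lambda>t. T r s t)"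
  using linear2[of r s] commute(2)[of r s] unfolding clinear_on_def by (simp add: mem)

lemma trilinear:
  shows "r \<in> J3 A \<Longrightarrow> u \<in> J3 A \<Longrightarrow> s \<in> J3 A \<Longrightarrow> t \<in> J3 A \<Longrightarrow> T (r + u) s t = T r s t + T u s t"
    "r \<in> J3 A \<Longrightarrow> u \<in> J3 A \<Longrightarrow> s \<in> J3 A \<Longrightarrow> t \<in> J3 A \<Longrightarrow> T r (s + u) t = T r s t + T r u t"
    "r \<in> J3 A \<Longrightarrow> u \<in> J3 A \<Longrightarrow> s \<in> J3 A \<Longrightarrow> t \<in> J3 A \<Longrightarrow> T r s (t + u) = T r s t + T r s u"
    "r \<in> J3 A \<Longrightarrow> s \<in> J3 A \<Longrightarrow> t \<in> J3 A \<Longrightarrow> T (c *\<^sub>C r) s t = c * T r s t"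
    "r \<in> J3 A \<Longrightarrow> s \<in> J3 A \<Longrightarrow> t \<in> J3 A \<Longrightarrow> T r (c *\<^sub>C s) t = c * T r s t"
    "r \<in> J3 A \<Longrightarrow> s \<in> J3 A \<Longrightarrow> t \<in> J3 A \<Longrightarrow> T r s (c *\<^sub>C t) = c * T r s t"
  using clinear_on_add[OF linear1] clinear_on_add[OF linear2] clinear_on_add[OF linear3]
    clinear_on_scaleC[OF linear1] clinear_on_scaleC[OF linear2] clinear_on_scaleC[OF linear3]
  by (simp_all add: scaleC_complex_def)

lemma trace_form_contract:
  assumes "r \<in> J3 A" "s \<in> J3 A" "t \<in> J3 A"
  shows "trace_form t (contract A T r s) = T r s t" "trace_form (contract A T r s) t = T r s t"
  using trace_form_contract_aux[OF A T assms] by (simp_all add: trace_form_commute)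

lemma contractI:
  assumes "r \<in> J3 A" "s \<in> J3 A" "u \<in> J3 A" "\<And>t. t \<in> J3 A \<Longrightarrow> trace_form t u = T r s t"
  shows "contract A T r s = u"
  by (rule trace_form_nondegenerate[OF A]) (simp_all add: assms mem trace_form_contract)

lemma contract_linear: "s \<in> J3 A \<Longrightarrow> clinear_on (J3 A) (J3 A) (\<lambda>r. contract A T r s)"
  by (rule clinear_onI; (rule contractI)?)
    (simp_all add: mem trilinear trace_form_contract trace_form_bilinear[OF A])

lemma contract_commute: "r \<in> J3 A \<Longrightarrow> s \<in> J3 A \<Longrightarrow> contract A T r s = contract A T s r"
  by (rule contractI) (simp_all add: mem trace_form_contract commute(1))

lemma contract_scaleC:
  assumes "r \<in> J3 A" "s \<in> J3 A"
  shows "contract A T (c *\<^sub>C r) s = c *\<^sub>C contract A T r s"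
    "contract A T r (c *\<^sub>C s) = c *\<^sub>C contract A T r s"
  using clinear_on_scaleC[OF contract_linear[OF assms(2)] assms(1)]
    clinear_on_scaleC[OF contract_linear[OF assms(1)] assms(2)]
  by (simp_all add: contract_commute assms mem)

lemma polynomial_map_contract:
  assumes Z: "complex_subspace Z" and pm: "polynomial_map A Z \<phi>" "polynomial_map A Z \<psi>"
  shows "polynomial_map A Z (\<lambda>w. contract A T (\<phi> w) (\<psi> w))"
  unfolding polynomial_map_def
proof (intro conjI allI impI)
  show "(\<lambda>w. contract A T (\<phi> w) (\<psi> w)) ` Z \<subseteq> J3 A"
    using pm by (auto simp: polynomial_map_mem mem)
  fix l :: "omat \<Rightarrow> complex" assume l: "clinear_on (J3 A) UNIV l"
  obtain u where u: "u \<in> J3 A" "\<And>t. t \<in> J3 A \<Longrightarrow> trace_form t u = l t"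
    using trace_form_riesz[OF A l] by blast
  show "polynomial_on Z (\<lambda>w. l (contract A T (\<phi> w) (\<psi> w)))"
  proof (rule polynomial_on_cong[OF Z])
    have "polynomial_map A Z (\<lambda>w. contract A T (\<psi> w) u)"
      unfolding polynomial_map_def
      using pm(2) contract_linear[OF u(1)] clinear_on_comp[OF contract_linear[OF u(1)]]
      by (auto simp: polynomial_map_mem mem u(1) intro!: polynomial_map_form[OF pm(2)])
    then show "polynomial_on Z (\<lambda>w. trace_form (\<phi> w) (contract A T (\<psi> w) u))"
      by (rule polynomial_map_pairing[OF A Z pm(1)])
    show "trace_form (\<phi> w) (contract A T (\<psi> w) u) = l (contract A T (\<phi> w) (\<psi> w))"
      if "w \<in> Z" for w
    proof -
      have "\<phi> w \<in> J3 A" "\<psi> w \<in> J3 A" using pm that by (auto simp: polynomial_map_mem)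
      then show ?thesis
        using commute by (simp add: trace_form_contract mem u(1) flip: u(2))
    qed
  qed
qed

lemma polynomial_on_cubic:
  assumes Z: "complex_subspace Z" and pm: "polynomial_map A Z \<phi>" "polynomial_map A Z \<psi>" "polynomial_map A Z \<zeta>"
  shows "polynomial_on Z (\<lambda>w. T (\<phi> w) (\<psi> w) (\<zeta> w))"
  by (rule polynomial_on_cong[OF Z polynomial_map_pairing[OF A Z pm(3) polynomial_map_contract[OF Z pm(1,2)]]])
    (use pm in \<open>auto simp: polynomial_map_mem trace_form_contract\<close>)

lemma polynomial_on_cube: "polynomial_on (J3 A) (\<lambda>r. T r r r)"
  by (intro polynomial_on_cubic[OF V] polynomial_map_linear clinear_onI) auto

lemma polarization:
  assumes "r \<in> J3 A" "s \<in> J3 A" "t \<in> J3 A"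
  shows "6 * T r s t = T (r + s + t) (r + s + t) (r + s + t) - T (r + s) (r + s) (r + s)
     - T (s + t) (s + t) (s + t) - T (r + t) (r + t) (r + t) + T r r r + T s s s + T t t t"
proof -
  have "T s r t = T r s t" "T r t s = T r s t" "T s t r = T r s t" "T t r s = T r s t" "T t s r = T r s t"
    using assms commute by metis+
  moreover have "T x y x = T x x y" "T y x x = T x x y" if "x \<in> J3 A" "y \<in> J3 A" for x y
    using that commute by metis+
  ultimately show ?thesis using assms by (simp add: trilinear mem)
qed

lemma contract_on_line:
  assumes "r \<in> J3 A" "v \<in> J3 A"
  shows "contract A T (r + k *\<^sub>C v) (r + k *\<^sub>C v) =
    contract A T r r + (2 * k) *\<^sub>C contract A T r v + k\<^sup>2 *\<^sub>C contract A T v v"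
proof (rule contractI)
  fix t assume "t \<in> J3 A"
  then show "trace_form t (contract A T r r + (2 * k) *\<^sub>C contract A T r v + k\<^sup>2 *\<^sub>C contract A T v v) =
      T (r + k *\<^sub>C v) (r + k *\<^sub>C v) t"
    using assms commute(1)[of v r t]
    by (simp add: trace_form_bilinear[OF A] trace_form_contract trilinear mem power2_eq_square
        algebra_simps)
qed (simp_all add: assms mem)

lemma cube_on_line:
  assumes "r \<in> J3 A" "v \<in> J3 A"
  shows "T (r + c *\<^sub>C v) (r + c *\<^sub>C v) (r + c *\<^sub>C v) =
     T r r r + 3 * c * T r r v + 3 * c^2 * T r v v + c^3 * T v v v"
proof -
  have "T r v r = T r r v" "T v r r = T r r v" "T v r v = T r v v" "T v v r = T r v v"
    using assms commute by metis+
  then show ?thesis using assms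
    by (simp add: trilinear mem algebra_simps power2_eq_square power3_eq_cube)
qed

lemma cube_derivative_on_line:
  assumes "r \<in> J3 A" "v \<in> J3 A"
  shows "((\<lambda>e. T (r + e *\<^sub>R v) (r + e *\<^sub>R v) (r + e *\<^sub>R v)) has_vector_derivative 3 * T r r v) (at 0)"
  unfolding scaleR_eq_scaleC cube_on_line[OF assms]
  by (rule has_vector_derivative_real_field) (auto intro!: derivative_eq_intros)

text \<open>The infinitesimal invariance of the cubic, polarized once: the difference of the values at
  \<open>r + v\<close> and \<open>r - v\<close> consists of the part linear in \<open>v\<close> and of a multiple of the value at \<open>v\<close>.\<close>

lemma annihilator_polarized:
  assumes X: "clinear_on (J3 A) (J3 A) X" and inv: "\<And>r. r \<in> J3 A \<Longrightarrow> T r r (X r) = 0"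
    and rv: "r \<in> J3 A" "v \<in> J3 A"
  shows "2 * T r (X r) v + T r r (X v) = 0"
proof -
  note X' = clinear_on_mem[OF X] clinear_on_add[OF X] clinear_on_minus[OF X]
  have neg: "- v = (-1) *\<^sub>C v" by (simp add: scaleC_minus_one)
  have "T (r + v) (r + v) (X (r + v)) - T (r - v) (r - v) (X (r - v)) - 2 * T v v (X v) =
     2 * (T r v (X r) + T v r (X r) + T r r (X v))"
    unfolding diff_conv_add_uminus neg using rv
    by (simp add: X' clinear_on_scaleC[OF X] trilinear mem)
  moreover have "T r v (X r) = T r (X r) v" "T v r (X r) = T r (X r) v"
    using rv X' commute by metis+
  ultimately have "4 * T r (X r) v + 2 * T r r (X v) = 0" using rv by (simp add: inv mem)
  moreover have "2 * T r (X r) v + T r r (X v) = (4 * T r (X r) v + 2 * T r r (X v)) / 2" by simp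
  ultimately show ?thesis by (simp only: div_0)
qed

end

section \<open>The normalized pair of cubics\<close>

lemma trace_form_zero: "s \<in> J3 A \<Longrightarrow> cnj_subalgebra A \<Longrightarrow> trace_form s 0 = 0"
  using trace_form_bilinear(4)[of A s s 0] by simp

lemma det_symmetric_trilinear:
  assumes A: "cnj_subalgebra A"
    and C: "\<And>r s t. r \<in> J3 A \<Longrightarrow> s \<in> J3 A \<Longrightarrow> t \<in> J3 A \<Longrightarrow> C r s t = a * jdet_polar r s t"
  shows "symmetric_trilinear_on (J3 A) C"
  unfolding symmetric_trilinear_on_def
proof (intro conjI ballI)
  fix r s t assume rst: "r \<in> J3 A" "s \<in> J3 A" "t \<in> J3 A"
  show "C r s t = C s r t"
    by (simp only: C rst jdet_polar_commute(1)[of r])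
  show "C r s t = C r t s"
    by (simp only: C rst jdet_polar_commute(2)[of r s])
next
  fix s t assume st: "s \<in> J3 A" "t \<in> J3 A"
  note V = complex_subspace_J3[OF A] and lin = jdet_polar_clinear[OF A st]
  show "clinear_on (J3 A) UNIV (\<lambda>r. C r s t)"
    by (rule clinear_onI) (simp_all add: C st csubspace_add[OF V] csubspace_scaleC[OF V]
      clinear_on_add[OF lin] clinear_on_scaleC[OF lin] scaleC_complex_def algebra_simps)
qed

lemma det_contract_square:
  assumes A: "cnj_subalgebra A"
    and C: "\<And>r s t. r \<in> J3 A \<Longrightarrow> s \<in> J3 A \<Longrightarrow> t \<in> J3 A \<Longrightarrow> C r s t = a * jdet_polar r s t"
    and r: "r \<in> J3 A"
  shows "contract A C r r = (a / 3) *\<^sub>C jadj r"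
proof -
  interpret cubic_form A C
    using A det_symmetric_trilinear[OF A C] by unfold_locales
  show ?thesis
    by (rule contractI) (simp_all add: r mem J3_jadj[OF A r] trace_form_bilinear[OF A]
        trace_form_jadj[OF r] C)
qed

text \<open>The normalization pins down the dual cubic. For \<open>t = r = jadj s\<close> it evaluates \<open>D\<close> at the
  elements \<open>s\<close> with nonzero determinant, because \<open>jadj (jadj s)\<close> is a multiple of \<open>s\<close>; these
  are Zariski dense, and polarization does the rest.\<close>

lemma normalized_dual_det:
  assumes A: "cnj_subalgebra A"
    and C: "\<And>r s t. r \<in> J3 A \<Longrightarrow> s \<in> J3 A \<Longrightarrow> t \<in> J3 A \<Longrightarrow> C r s t = a * jdet_polar r s t"
    and a: "a \<noteq> 0" and D: "symmetric_trilinear_on (J3 A) D" and norm: "normalized A C D"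
    and rst: "r \<in> J3 A" "s \<in> J3 A" "t \<in> J3 A"
  shows "D r s t = (54 / a) * jdet_polar r s t"
proof -
  interpret C: cubic_form A C
    using A det_symmetric_trilinear[OF A C] by unfold_locales
  interpret D: cubic_form A D
    using A D by unfold_locales
  have det: "polynomial_on (J3 A) jdet"
    by (rule polynomial_on_cong[OF C.V poly_mult[OF poly_const[of _ "1/a"] C.polynomial_on_cube]])
      (simp add: C jdet_polar_diag a)
  have nonzero: "D s s s - (54 / a) * jdet s = 0" if s: "s \<in> J3 A" and N: "jdet s \<noteq> 0" for s
  proof -
    define r where "r = jadj s"
    have r: "r \<in> J3 A" unfolding r_def by (rule J3_jadj[OF A s])
    have Crr: "contract A C r r = (a / 3 * jdet s) *\<^sub>C s"
      using det_contract_square[OF A C r] jadj_jadj[OF s] by (simp add: r_def scaleC_scaleC)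
    have rs: "trace_form r s = 3 * jdet s"
      using trace_form_jadj[OF s s] jdet_polar_diag[OF s] by (simp add: r_def trace_form_commute)
    have Crrr: "C r r r = a * jdet s * jdet s"
      using C.trace_form_contract(1)[OF r r r] s r
      by (simp add: Crr trace_form_bilinear[OF A] rs mult.assoc)
    have "2 * trace_form (contract A D s (contract A C r r)) (contract A C r r) =
        trace_form r s * C r r r + 3 * trace_form r s * C r r r"
      using norm r s unfolding normalized_def by blast
    moreover have "trace_form (contract A D s (contract A C r r)) (contract A C r r)
        = (a / 3 * jdet s) * (a / 3 * jdet s) * D s s s"
      unfolding Crr using s by (simp add: D.trace_form_contract D.mem D.trilinear)
    ultimately have "2 * ((a / 3 * jdet s) * (a / 3 * jdet s) * D s s s) =
        3 * jdet s * (a * jdet s * jdet s) + 3 * (3 * jdet s) * (a * jdet s * jdet s)"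
      by (simp only: rs Crrr)
    then show ?thesis using N a by (simp add: field_simps)
  qed
  have cube: "D s s s = (54 / a) * jdet s" if s: "s \<in> J3 A" for s
  proof -
    have "D s s s - (54 / a) * jdet s = 0"
    proof (rule polynomial_on_integral_domain[OF C.V _ det _ J3_omat_one[OF A] _ s])
      show "polynomial_on (J3 A) (\<lambda>s. D s s s - (54 / a) * jdet s)"
        by (intro polynomial_on_diff D.polynomial_on_cube poly_mult poly_const det)
    qed (use nonzero in \<open>auto simp: jdet_omat_one\<close>)
    then show ?thesis by simp
  qed
  have "6 * D r s t = (54 / a) * (6 * jdet_polar r s t)"
    unfolding D.polarization[OF rst] using rst
    by (simp add: cube D.mem jdet_polar_def algebra_simps)
  then have "6 * D r s t = 6 * ((54 / a) * jdet_polar r s t)" by (simp only: mult.left_commute)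
  then show ?thesis by (simp only: mult_cancel_left) simp
qed


text \<open>The situation after the dual cubic has been identified. The relation \<open>a * b = 54\<close> is the
  normalization evaluated at the identity matrix.\<close>

locale normalized_dets =
  fixes A :: "oct set" and C D :: trilinear and a b :: complex
  assumes A: "cnj_subalgebra A"
    and C_det: "\<And>r s t. r \<in> J3 A \<Longrightarrow> s \<in> J3 A \<Longrightarrow> t \<in> J3 A \<Longrightarrow> C r s t = a * jdet_polar r s t"
    and D_det: "\<And>r s t. r \<in> J3 A \<Longrightarrow> s \<in> J3 A \<Longrightarrow> t \<in> J3 A \<Longrightarrow> D r s t = b * jdet_polar r s t"
    and ab: "a * b = 54"
    and normalized: "normalized A C D"
begin

sublocale C: cubic_form A C
  using A det_symmetric_trilinear[OF A C_det] by unfold_locales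

sublocale D: cubic_form A D
  using A det_symmetric_trilinear[OF A D_det] by unfold_locales

abbreviation "W \<equiv> J3 A"
abbreviation "c \<equiv> contract A C"
abbreviation "d \<equiv> contract A D"
abbreviation "I \<equiv> omat_one"

lemmas subspace_W = C.V
lemmas tr = trace_form_bilinear[OF A]
lemmas tr_commute = trace_form_commute
lemmas mem = C.mem D.mem J3_omat_one[OF A]

lemma nonzero: "a \<noteq> 0" "b \<noteq> 0"
  using ab by auto

lemma C_one: "C I I I = a" and D_one: "D I I I = b"
  using mem by (simp_all add: C_det D_det jdet_polar_diag jdet_omat_one)

lemma c_one: "c I I = (a / 3) *\<^sub>C I" and d_one: "d I I = (b / 3) *\<^sub>C I"
  using det_contract_square[OF A C_det] det_contract_square[OF A D_det] mem
  by (simp_all add: jadj_omat_one)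

lemma normCD:
  assumes "r \<in> W" "s \<in> W" "t \<in> W"
  shows "2 * D s (c r t) (c r r) = trace_form t s * C r r r + 3 * trace_form r s * C r r t"
  using normalized assms unfolding normalized_def
  by (simp add: D.trace_form_contract mem)

lemma d_scaled_c:
  assumes "r \<in> W" "s \<in> W" shows "d r s = (b / a) *\<^sub>C c r s"
  by (rule D.contractI)
    (simp_all add: assms mem tr C.trace_form_contract C_det D_det nonzero)

text \<open>Both cubics being multiples of the determinant, the normalization is symmetric in them.\<close>

lemma normDC:
  assumes "r \<in> W" "s \<in> W" "u \<in> W"
  shows "2 * C r (d s u) (d s s) = trace_form u r * D s s s + 3 * trace_form s r * D s s u"
proof -
  have DC: "D x y z = (b / a) * C x y z" if "x \<in> W" "y \<in> W" "z \<in> W" for x y z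
    using that nonzero by (simp add: C_det D_det)
  have "2 * C r (d s u) (d s s) = (b / a) * (2 * D r (c s u) (c s s))"
    using assms by (simp add: d_scaled_c C.trilinear DC mem)
  also have "\<dots> = (b / a) * (trace_form u r * C s s s + 3 * trace_form s r * C s s u)"
    using normCD[OF assms(2,1,3)] by simp
  also have "\<dots> = trace_form u r * D s s s + 3 * trace_form s r * D s s u"
    using assms by (simp add: DC algebra_simps)
  finally show ?thesis .
qed

text \<open>Freudenthal's identity \<open>jadj (jadj s) = jdet s * s\<close> in terms of the two contractions.\<close>

lemma c_square_d_square:
  assumes "s \<in> W" shows "c (d s s) (d s s) = (2 * D s s s) *\<^sub>C s"
proof (rule C.contractI)
  fix t assume t: "t \<in> W"
  have "2 * C t (d s s) (d s s) = 4 * (trace_form s t * D s s s)"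
    using normDC[OF t assms assms] by simp
  moreover have "C (d s s) (d s s) t = C t (d s s) (d s s)"
    using C.commute assms t mem by metis
  ultimately show "trace_form t ((2 * D s s s) *\<^sub>C s) = C (d s s) (d s s) t"
    using assms t by (simp add: tr tr_commute[of t s])
qed (simp_all add: assms mem)

section \<open>The Lie algebra of the group of the determinant\<close>

definition annihilators :: "(omat \<Rightarrow> omat) set" where
  "annihilators = {X. clinear_on W W X \<and> (\<forall>r\<in>W. C r r (X r) = 0)}"

text \<open>If \<open>r\<close> is in the radical, then \<open>c I r = 0\<close>, and the normalization with \<open>t = r\<close> at the
  identity matrix reduces to \<open>\<langle>r, s\<rangle> C(I, I, I) = 0\<close>.\<close>

lemma C_nondegenerate:
  assumes r: "r \<in> W" and zero: "\<And>x. x \<in> W \<Longrightarrow> C x x r = 0"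
  shows "r = 0"
proof -
  have "C x y r = 0" if "x \<in> W" "y \<in> W" for x y
  proof -
    have "C (x + y) (x + y) r = C x x r + 2 * C x y r + C y y r"
      using that r C.commute(1)[of x y r] by (simp add: C.trilinear mem)
    then show ?thesis using zero that by (simp add: mem)
  qed
  then have "c I r = 0"
    using C.commute(2)[of I r] r by (intro C.contractI) (simp_all add: mem trace_form_zero[OF _ A])
  have "trace_form t r = 0" if t: "t \<in> W" for t
  proof -
    have "D t (0 *\<^sub>C I) (c I I) = 0"
      using t by (simp only: D.trilinear(5) mem mult_zero_left)
    then show ?thesis
      using normCD[of I t r] \<open>c I r = 0\<close> zero[of I] t r nonzero
      by (simp add: mem C_one tr_commute)
  qed
  then show ?thesis
    by (intro trace_form_nondegenerate[OF A]) (simp_all add: r mem trace_form_zero[OF _ A])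
qed

lemma annihilators_polarized:
  assumes "X \<in> annihilators" "r \<in> W" "v \<in> W"
  shows "2 * C r (X r) v + C r r (X v) = 0"
  using C.annihilator_polarized[of X r v] assms unfolding annihilators_def by blast

text \<open>A vector \<open>r\<close> in the kernel of \<open>g\<close> may be added to the argument without changing the cubic.
  Hence \<open>C(x, x, r)\<close>, the part linear in \<open>r\<close>, vanishes for all \<open>x\<close>, and nondegeneracy applies.\<close>

lemma cubic_preserving_bij:
  assumes "clinear_on W W g" and cube: "\<And>r. r \<in> W \<Longrightarrow> C (g r) (g r) (g r) = C r r r"
  shows "bij_betw g W W"
proof -
  note g = clinear_on_mem[OF assms(1)] clinear_on_add[OF assms(1)] clinear_on_scaleC[OF assms(1)]
  obtain G where G: "linear G" "\<And>x. x \<in> W \<Longrightarrow> G x = g x"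
    using linear_extension[OF subspace_W assms(1)] by metis
  have ker: "r = 0" if r: "r \<in> W" and gr: "g r = 0" for r
  proof (rule C_nondegenerate[OF r])
    fix x assume x: "x \<in> W"
    have shift: "C (x + k *\<^sub>C r) (x + k *\<^sub>C r) (x + k *\<^sub>C r) = C x x x" for k
      using cube[of "x + k *\<^sub>C r"] cube[OF x] x r gr by (simp add: g mem)
    have "3 * k * C x x r + 3 * k\<^sup>2 * C x r r + k ^ 3 * C r r r = 0" for k
      using shift[of k] C.cube_on_line[OF x r, of k] by (simp add: add.assoc)
    \<comment> \<open>Three values of \<open>k\<close> separate the homogeneous parts.\<close>
    from this[of 1] this[of "-1"] this[of 2] show "C x x r = 0"
      by simp algebra
  qed
  have inj: "inj_on g W"
  proof (rule inj_onI)
    fix x y assume xy: "x \<in> W" "y \<in> W" "g x = g y"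
    then have "g (x - y) = 0" using clinear_on_diff[OF assms(1) subspace_W] by simp
    then show "x = y" using ker[of "x - y"] xy by (simp add: mem)
  qed
  have "inj_on G (span W)"
    using inj G(2) csubspace_subspace[OF subspace_W] by (simp add: inj_on_def span_eq_iff[THEN iffD2])
  then have "dim (G ` W) = dim W" by (rule dim_image_eq[OF G(1)])
  moreover have "G ` W \<subseteq> W" using G(2) g(1) by auto
  moreover have "subspace (G ` W)"
    by (rule linear_subspace_image[OF G(1) csubspace_subspace[OF subspace_W]])
  ultimately have "G ` W = W"
    using subspace_dim_equal[of "G ` W" W] csubspace_subspace[OF subspace_W] by simp
  then have "g ` W = W" using G(2) by (simp add: image_def)
  then show ?thesis using inj by (simp add: bij_betw_def)
qed

lemma C_cube_det: "r \<in> W \<Longrightarrow> C r r r = a * jdet r"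
  by (simp add: C_det jdet_polar_diag)

text \<open>An operator that annihilates the cubic has a flow that preserves it, and conversely by
  differentiation at the identity.\<close>

lemma lie_algebra_SL3: "lie_algebra_of W (SL3 A) = annihilators"
proof (intro set_eqI iffI)
  fix X assume X: "X \<in> annihilators"
  then have lin: "clinear_on W W X" and inv: "\<And>r. r \<in> W \<Longrightarrow> C r r (X r) = 0"
    by (auto simp: annihilators_def)
  have "op_exp (\<lambda>v. k *\<^sub>R X v) \<in> SL3 A" for k
  proof -
    let ?g = "op_exp (\<lambda>v. k *\<^sub>R X v)"
    have lg: "clinear_on W W ?g" by (rule op_exp_linear[OF subspace_W lin])
    have cube: "C (?g r) (?g r) (?g r) = C r r r" if "r \<in> W" for r
    proof (rule polynomial_on_flow_invariant[OF subspace_W C.polynomial_on_cube lin _ that])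
      fix w assume w: "w \<in> W"
      show "((\<lambda>e. C (w + e *\<^sub>R X w) (w + e *\<^sub>R X w) (w + e *\<^sub>R X w)) has_vector_derivative 0) (at 0)"
        using C.cube_derivative_on_line[OF w clinear_on_mem[OF lin w]] inv[OF w] by simp
    qed
    have "jdet (?g r) = jdet r" if "r \<in> W" for r
      using cube[OF that] that clinear_on_mem[OF lg that] nonzero by (simp add: C_cube_det)
    then show ?thesis
      using lg cubic_preserving_bij[OF lg cube] by (simp add: SL3_def)
  qed
  then show "X \<in> lie_algebra_of W (SL3 A)"
    using lin by (simp add: lie_algebra_of_def)
next
  fix X assume "X \<in> lie_algebra_of W (SL3 A)"
  then have lin: "clinear_on W W X" and G: "\<And>k. op_exp (\<lambda>v. k *\<^sub>R X v) \<in> SL3 A"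
    by (auto simp: lie_algebra_of_def)
  have "C r r (X r) = 0" if r: "r \<in> W" for r
  proof -
    have inv: "C (op_exp (\<lambda>v. k *\<^sub>R X v) r) (op_exp (\<lambda>v. k *\<^sub>R X v) r) (op_exp (\<lambda>v. k *\<^sub>R X v) r) = C r r r"
      for k
      using G[of k] r by (simp add: SL3_def C_cube_det op_exp_mem[OF subspace_W lin])
    have Xr: "X r \<in> W" by (rule clinear_on_mem[OF lin r])
    have "((\<lambda>e. r + e *\<^sub>R X r) has_vector_derivative X r) (at 0)"
      by (auto intro!: derivative_eq_intros)
    from polynomial_on_infinitesimal_invariant[OF subspace_W C.polynomial_on_cube lin inv r _ _ this]
    have "((\<lambda>e. C (r + e *\<^sub>R X r) (r + e *\<^sub>R X r) (r + e *\<^sub>R X r)) has_vector_derivative 0) (at 0)"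
      using r Xr by (simp add: image_subset_iff mem)
    from vector_derivative_unique_at[OF this C.cube_derivative_on_line[OF r Xr]]
    show ?thesis by simp
  qed
  then show "X \<in> annihilators" using lin by (simp add: annihilators_def)
qed

lemma zero_annihilator: "(\<lambda>_. 0) \<in> annihilators"
  using clinear_on_zero[OF C.linear3 subspace_W]
  by (auto simp: annihilators_def mem intro!: clinear_onI)

lemma scaleR_annihilator: "X \<in> annihilators \<Longrightarrow> (\<lambda>v. k *\<^sub>R X v) \<in> annihilators"
  by (auto simp: annihilators_def clinear_on_def mem scaleR_eq_scaleC scaleC_add_right
      scaleC_scaleC mult.commute C.trilinear image_subset_iff)

lemma annihilator_mem: "X \<in> annihilators \<Longrightarrow> r \<in> W \<Longrightarrow> X r \<in> W"
  by (auto simp: annihilators_def clinear_on_mem)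

lemma annihilator_linear: "X \<in> annihilators \<Longrightarrow> clinear_on W W X"
  by (simp add: annihilators_def)

text \<open>The dual action preserves the dual cubic: every \<open>s\<close> with \<open>D s s s \<noteq> 0\<close> is a multiple of
  \<open>c q q\<close> with \<open>q = d s s\<close>, so that the claim for \<open>s\<close> follows from invariance of \<open>C\<close> at \<open>q\<close>. Such \<open>s\<close> are Zariski
  dense.\<close>

lemma dual_annihilates:
  assumes X: "X \<in> annihilators" and s: "s \<in> W"
  shows "D s s (dual_lie_act A X s) = 0"
proof -
  note lin = annihilator_linear[OF X] and X_mem = annihilator_mem[OF X]
  let ?X' = "dual_lie_act A X"
  have X'_mem: "?X' s \<in> W" if "s \<in> W" for s by (rule dual_lie_mem[OF A lin that])
  show ?thesis
  proof (rule polynomial_on_integral_domain[OF subspace_W _ D.polynomial_on_cube _ J3_omat_one[OF A] _ s])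
    show "polynomial_on W (\<lambda>s. D s s (?X' s))"
      by (intro D.polynomial_on_cubic[OF subspace_W] polynomial_map_linear dual_lie_clinear[OF A lin] clinear_onI)
        auto
    fix s assume s: "s \<in> W" and nz: "D s s s \<noteq> 0"
    define q where "q = d s s"
    have q: "q \<in> W" using s by (simp add: q_def mem)
    have "D s s (?X' s) = trace_form q (?X' s)"
      using s by (simp add: q_def D.trace_form_contract X'_mem)
    also have "\<dots> = - trace_form (X q) s"
      by (rule trace_form_dual_lie[OF A lin s q])
    finally have "2 * D s s s * D s s (?X' s) = - trace_form (X q) ((2 * D s s s) *\<^sub>C s)"
      using s X_mem[OF q] by (simp add: tr)
    also have "\<dots> = - C q q (X q)"
      using c_square_d_square[OF s] C.trace_form_contract(1)[OF q q X_mem[OF q]]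
      by (simp add: q_def)
    also have "\<dots> = 0" using X q by (simp add: annihilators_def)
    finally show "D s s (?X' s) = 0" using nz by simp
  qed (simp add: D_one nonzero)
qed

text \<open>The operators \<open>r \<mapsto> 2 d(u, c(r, t)) - 3\<langle>r, u\<rangle> t - \<langle>t, u\<rangle> r\<close> annihilate the cubic by the
  normalization. For \<open>t = d(s, s)\<close> their dual actions carry \<open>s\<close> to every vector tangent to the
  level set of the dual cubic at \<open>s\<close>.\<close>

lemma annihilators_transitive:
  assumes s: "s \<in> W" and nz: "D s s s \<noteq> 0" and v: "v \<in> W" and tangent: "D s s v = 0"
  obtains X where "X \<in> annihilators" "dual_lie_act A X s = v"
proof -
  define u where "u = (1 / (2 * D s s s)) *\<^sub>C v"
  define t where "t = d s s"
  have u: "u \<in> W" and t: "t \<in> W" using s v by (simp_all add: u_def t_def mem)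
  define X where "X r = 2 *\<^sub>C d u (c r t) + (- 3 * trace_form r u) *\<^sub>C t + (- trace_form t u) *\<^sub>C r" for r
  have X_mem: "X r \<in> W" if "r \<in> W" for r using that u t by (simp add: X_def mem)
  have trX: "trace_form (X r) y = 2 * D u (c r t) y - 3 * trace_form r u * trace_form t y
      - trace_form t u * trace_form r y" if "r \<in> W" "y \<in> W" for r y
    using that u t by (simp add: X_def tr mem D.trace_form_contract)
  have lin: "clinear_on W W X"
  proof (rule clinear_onI[OF X_mem])
    fix x y assume xy: "x \<in> W" "y \<in> W"
    show "X (x + y) = X x + X y"
      by (rule trace_form_nondegenerate[OF A])
        (simp_all add: xy X_mem mem tr u t trX tr_commute[of _ "X _"] clinear_on_add[OF C.contract_linear]
          D.trilinear algebra_simps)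
  next
    fix k x assume x: "x \<in> W"
    show "X (k *\<^sub>C x) = k *\<^sub>C X x"
      by (rule trace_form_nondegenerate[OF A])
        (simp_all add: x X_mem mem tr u t trX tr_commute[of _ "X _"] C.contract_scaleC
          D.trilinear algebra_simps)
  qed
  have "C r r (X r) = 0" if r: "r \<in> W" for r
  proof -
    have "C r r (X r) = trace_form (X r) (c r r)"
      using r X_mem by (simp add: C.trace_form_contract)
    also have "\<dots> = 0"
      using normCD[OF r u t] r t by (simp add: trX mem C.trace_form_contract)
    finally show ?thesis .
  qed
  then have X: "X \<in> annihilators" using lin by (simp add: annihilators_def)
  have tu: "trace_form t u = 0"
    using s v u tangent by (simp add: t_def D.trace_form_contract) (simp add: u_def D.trilinear)
  have ts: "trace_form t s = D s s s" using s by (simp add: t_def D.trace_form_contract)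
  have "dual_lie_act A X s = v"
  proof (rule trace_form_nondegenerate[OF A dual_lie_mem[OF A lin s] v])
    fix r assume r: "r \<in> W"
    have "D u (c r t) s = trace_form (d s u) (c r t)"
      using D.commute r u s t mem by (simp add: D.trace_form_contract)
    also have "\<dots> = C r (d s u) (d s s)"
      using C.commute r u s t mem by (simp add: C.trace_form_contract t_def)
    finally have "2 * D u (c r t) s = trace_form u r * D s s s + 3 * trace_form s r * D s s u"
      using normDC[OF r s u] by simp
    moreover have "D s s u = 0" using s v tangent by (simp add: u_def D.trilinear)
    ultimately have "trace_form r (dual_lie_act A X s) = 2 * D s s s * trace_form r u"
      using trace_form_dual_lie[OF A lin s r] r s
      by (simp add: trX tu ts tr_commute[of u r])
    also have "\<dots> = trace_form r v" using r v nz by (simp add: u_def tr)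
    finally show "trace_form r (dual_lie_act A X s) = trace_form r v" .
  qed
  then show ?thesis using X that by blast
qed

section \<open>The quartic and its infinitesimal invariance\<close>

lemma Z2_iff: "(\<alpha>, r, s, \<beta>) \<in> Z2 A \<longleftrightarrow> r \<in> W \<and> s \<in> W"
  by (simp add: Z2_def)

lemma subspace_Z2: "complex_subspace (Z2 A)"
  unfolding Z2_def by (intro complex_subspace_Times complex_subspace_UNIV subspace_W)

lemma zorn_act_eq: "zorn_act A C D X k t u (\<alpha>, r, s, \<beta>) =
  (1 / 2 * trace_form r u - 3 / 2 * k * \<alpha>,
   X r + (- (1 / 2) * k) *\<^sub>C r + (3 * \<alpha>) *\<^sub>C t + d s u,
   dual_lie_act A X s + (1 / 2 * k) *\<^sub>C s + c r t + (3 * \<beta>) *\<^sub>C u,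
   3 / 2 * k * \<beta> + 1 / 2 * trace_form t s)"
  by (simp add: zorn_act_def)

lemma zorn_act_linear:
  assumes X: "X \<in> annihilators" and t: "t \<in> W" and u: "u \<in> W"
  shows "clinear_on (Z2 A) (Z2 A) (zorn_act A C D X k t u)"
proof -
  note lin = annihilator_linear[OF X] and lin' = dual_lie_clinear[OF A annihilator_linear[OF X]]
  note cl = C.contract_linear[OF t] and dl = D.contract_linear[OF u]
  note simps = zorn_act_eq Z2_iff mem t u clinear_on_mem[OF lin] clinear_on_mem[OF lin']
    clinear_on_add[OF lin] clinear_on_add[OF lin'] clinear_on_add[OF cl] clinear_on_add[OF dl]
    clinear_on_scaleC[OF lin] clinear_on_scaleC[OF lin'] clinear_on_scaleC[OF cl] clinear_on_scaleC[OF dl]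
    scaleC_prod_def scaleC_add_left scaleC_add_right scaleC_scaleC scaleC_complex_def tr
  show ?thesis
  proof (rule clinear_onI)
    show "zorn_act A C D X k t u w \<in> Z2 A" if "w \<in> Z2 A" for w
      using that by (cases w) (simp add: simps)
    show "zorn_act A C D X k t u (w + w') = zorn_act A C D X k t u w + zorn_act A C D X k t u w'"
      if "w \<in> Z2 A" "w' \<in> Z2 A" for w w'
      using that by (cases w; cases w') (simp add: simps algebra_simps)
    show "zorn_act A C D X k t u (l *\<^sub>C w) = l *\<^sub>C zorn_act A C D X k t u w" if "w \<in> Z2 A" for l w
      using that by (cases w) (simp add: simps algebra_simps)
  qed
qed

text \<open>The derivative of the quartic at \<open>(\<alpha>, r, s, \<beta>)\<close> in the direction \<open>(\<alpha>', r', s', \<beta>')\<close>. Being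
  linear in the direction, it can be examined separately on the four summands of the Lie
  algebra.\<close>

definition quartic_deriv ::
  "complex \<Rightarrow> omat \<Rightarrow> omat \<Rightarrow> complex \<Rightarrow> complex \<Rightarrow> omat \<Rightarrow> omat \<Rightarrow> complex \<Rightarrow> complex" where
  "quartic_deriv \<alpha> r s \<beta> \<alpha>' r' s' \<beta>' =
     2 * (3 * \<alpha> * \<beta> - 1 / 2 * trace_form r s) *
         (3 * (\<alpha>' * \<beta> + \<alpha> * \<beta>') - 1 / 2 * (trace_form r' s + trace_form r s'))
     + 1 / 3 * (\<beta>' * C r r r + 3 * \<beta> * C r r r' + \<alpha>' * D s s s + 3 * \<alpha> * D s s s')
     - 1 / 3 * (D s s' (c r r) + C r r' (d s s))"

lemma quartic_line_derivative:
  assumes rs: "r \<in> W" "s \<in> W" "r' \<in> W" "s' \<in> W"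
  shows "((\<lambda>e. quartic A C D ((\<alpha>, r, s, \<beta>) + e *\<^sub>R (\<alpha>', r', s', \<beta>'))) has_vector_derivative
     quartic_deriv \<alpha> r s \<beta> \<alpha>' r' s' \<beta>') (at 0)"
proof -
  have pair: "trace_form (d s1 s2) (c r1 r2) = D s1 s2 (c r1 r2)"
    if "r1 \<in> W" "r2 \<in> W" "s1 \<in> W" "s2 \<in> W" for r1 r2 s1 s2
    using that by (simp add: D.trace_form_contract mem)
  have flip: "D s s (c r r') = C r r' (d s s)"
    using rs by (simp add: pair[symmetric] C.trace_form_contract mem)
  have "quartic A C D ((\<alpha>, r, s, \<beta>) + e *\<^sub>R (\<alpha>', r', s', \<beta>')) =
    (\<lambda>k. (3 * (\<alpha> + k * \<alpha>') * (\<beta> + k * \<beta>')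
        - 1 / 2 * (trace_form r s + k * (trace_form r' s + trace_form r s') + k\<^sup>2 * trace_form r' s'))\<^sup>2
     + 1 / 3 * ((\<beta> + k * \<beta>') * (C r r r + 3 * k * C r r r' + 3 * k\<^sup>2 * C r r' r' + k^3 * C r' r' r')
        + (\<alpha> + k * \<alpha>') * (D s s s + 3 * k * D s s s' + 3 * k\<^sup>2 * D s s' s' + k^3 * D s' s' s'))
     - 1 / 6 * (D s s (c r r) + 2 * k * (D s s' (c r r) + C r r' (d s s))
       + k\<^sup>2 * (D s' s' (c r r) + 4 * D s s' (c r r') + D s s (c r' r'))
       + k^3 * (2 * D s' s' (c r r') + 2 * D s s' (c r' r')) + k^4 * D s' s' (c r' r')))
     (complex_of_real e)" for e
  proof -
    define k where "k = complex_of_real e"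
    have "trace_form (r + k *\<^sub>C r') (s + k *\<^sub>C s') =
        trace_form r s + k * (trace_form r' s + trace_form r s') + k\<^sup>2 * trace_form r' s'"
      using rs by (simp add: tr mem power2_eq_square algebra_simps)
    moreover have "trace_form (d (s + k *\<^sub>C s') (s + k *\<^sub>C s')) (c (r + k *\<^sub>C r') (r + k *\<^sub>C r')) =
       D s s (c r r) + 2 * k * (D s s' (c r r) + C r r' (d s s))
       + k\<^sup>2 * (D s' s' (c r r) + 4 * D s s' (c r r') + D s s (c r' r'))
       + k^3 * (2 * D s' s' (c r r') + 2 * D s s' (c r' r')) + k^4 * D s' s' (c r' r')"
      unfolding C.contract_on_line[OF rs(1,3)] D.contract_on_line[OF rs(2,4)] flip[symmetric]
      using rs by (simp add: tr mem pair power2_eq_square power3_eq_cube power4_eq_xxxx algebra_simps)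
    ultimately show ?thesis
      using C.cube_on_line[OF rs(1,3), of k] D.cube_on_line[OF rs(2,4), of k]
      by (simp add: quartic_def scaleR_eq_scaleC scaleC_prod_def scaleC_complex_def flip: k_def)
  qed
  then show ?thesis
    by (simp only:) (rule has_vector_derivative_real_field,
      auto intro!: derivative_eq_intros simp: quartic_deriv_def algebra_simps)
qed

lemma quartic_deriv_add:
  assumes "r \<in> W" "s \<in> W" "r' \<in> W" "s' \<in> W" "r'' \<in> W" "s'' \<in> W"
  shows "quartic_deriv \<alpha> r s \<beta> (\<alpha>' + \<alpha>'') (r' + r'') (s' + s'') (\<beta>' + \<beta>'') =
    quartic_deriv \<alpha> r s \<beta> \<alpha>' r' s' \<beta>' + quartic_deriv \<alpha> r s \<beta> \<alpha>'' r'' s'' \<beta>''"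
  using assms by (simp add: quartic_deriv_def tr C.trilinear D.trilinear mem algebra_simps)

text \<open>All terms but the last are derivatives of invariants. For the mixed term the polarized
  invariance of \<open>C\<close> and of \<open>D\<close> moves \<open>X\<close> to \<open>d s s\<close> and its dual to \<open>c r r\<close>, where the two
  contributions cancel by duality.\<close>

lemma quartic_deriv_annihilator:
  assumes X: "X \<in> annihilators" and rs: "r \<in> W" "s \<in> W"
  shows "quartic_deriv \<alpha> r s \<beta> 0 (X r) (dual_lie_act A X s) 0 = 0"
proof -
  let ?X' = "dual_lie_act A X"
  note lin = annihilator_linear[OF X]
  note lin' = dual_lie_clinear[OF A lin]
  have m: "X r \<in> W" "?X' s \<in> W" "X (d s s) \<in> W"
    using rs by (simp_all add: clinear_on_mem[OF lin] clinear_on_mem[OF lin'] mem)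
  have "trace_form (X r) s + trace_form r (?X' s) = 0"
    using trace_form_dual_lie[OF A lin rs(2,1)] by simp
  moreover have "C r r (X r) = 0" using X rs by (simp add: annihilators_def)
  moreover have "D s s (?X' s) = 0" by (rule dual_annihilates[OF X rs(2)])
  moreover have "D s (?X' s) (c r r) + C r (X r) (d s s) = 0"
  proof -
    have 1: "2 * D s (?X' s) (c r r) + D s s (?X' (c r r)) = 0"
      by (rule D.annihilator_polarized[OF lin' dual_annihilates[OF X]]) (simp_all add: rs mem)
    have 2: "2 * C r (X r) (d s s) + C r r (X (d s s)) = 0"
      by (rule annihilators_polarized[OF X]) (simp_all add: rs mem)
    have "D s s (?X' (c r r)) = trace_form (d s s) (?X' (c r r))"
      using rs clinear_on_mem[OF lin'] by (simp add: D.trace_form_contract mem)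
    also have "\<dots> = - C r r (X (d s s))"
      using trace_form_dual_lie[OF A lin, of "c r r" "d s s"] rs m by (simp add: C.trace_form_contract mem)
    finally have "2 * D s (?X' s) (c r r) + 2 * C r (X r) (d s s) = 0"
      using 1 2 by (simp add: algebra_simps)
    then show ?thesis by (simp only: mult_eq_0_iff flip: distrib_left) simp
  qed
  ultimately show ?thesis by (simp add: quartic_deriv_def)
qed

lemma quartic_deriv_scalar:
  assumes rs: "r \<in> W" "s \<in> W"
  shows "quartic_deriv \<alpha> r s \<beta> (- (3 / 2) * k * \<alpha>) ((- (1 / 2) * k) *\<^sub>C r) ((1 / 2 * k) *\<^sub>C s) (3 / 2 * k * \<beta>) = 0"
proof -
  have "C r r (d s s) = D s s (c r r)"
    using rs D.trace_form_contract(2)[of s s "c r r"] by (simp add: C.trace_form_contract mem)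
  then show ?thesis
    using rs by (simp add: quartic_deriv_def tr C.trilinear D.trilinear mem algebra_simps)
qed

text \<open>The normalization enters here: it expresses the term \<open>D(s, c(r, t), c(r, r))\<close>, which no other
  summand of the quartic produces, by products of lower invariants.\<close>

lemma quartic_deriv_W:
  assumes rs: "r \<in> W" "s \<in> W" and t: "t \<in> W"
  shows "quartic_deriv \<alpha> r s \<beta> 0 ((3 * \<alpha>) *\<^sub>C t) (c r t) (1 / 2 * trace_form t s) = 0"
proof -
  have 1: "D s s (c r t) = C r t (d s s)"
    using rs t D.trace_form_contract(2)[of s s "c r t"] by (simp add: C.trace_form_contract mem)
  have 2: "trace_form r (c r t) = C r r t"
    using rs t C.commute(2)[of r t r] by (simp add: C.trace_form_contract mem)
  have 3: "2 * D s (c r t) (c r r) = trace_form t s * C r r r + 3 * trace_form r s * C r r t"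
    by (rule normCD[OF rs t])
  have "6 * quartic_deriv \<alpha> r s \<beta> 0 ((3 * \<alpha>) *\<^sub>C t) (c r t) (1 / 2 * trace_form t s) =
    6 * (3 * \<alpha> * \<beta> - 1 / 2 * trace_form r s) * (- C r r t)
     + (trace_form t s * C r r r + 18 * \<alpha> * \<beta> * C r r t + 6 * \<alpha> * D s s (c r t))
     - (2 * D s (c r t) (c r r) + 6 * \<alpha> * C r t (d s s))"
    using rs t by (simp add: quartic_deriv_def tr C.trilinear mem 2 algebra_simps)
  also have "\<dots> = 0" unfolding 1 3 by (simp add: algebra_simps)
  finally show ?thesis by simp
qed

lemma quartic_deriv_dual:
  assumes rs: "r \<in> W" "s \<in> W" and u: "u \<in> W"
  shows "quartic_deriv \<alpha> r s \<beta> (1 / 2 * trace_form r u) (d s u) ((3 * \<beta>) *\<^sub>C u) 0 = 0"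
proof -
  have 1: "C r r (d s u) = D s u (c r r)"
    using rs u C.trace_form_contract(2)[of r r "d s u"] by (simp add: D.trace_form_contract mem)
  have 2: "trace_form (d s u) s = D s s u"
    using rs u D.commute(2)[of s u s] by (simp add: D.trace_form_contract mem)
  have 3: "2 * C r (d s u) (d s s) = trace_form r u * D s s s + 3 * trace_form r s * D s s u"
    using normDC[OF rs u] by (simp add: tr_commute)
  have "6 * quartic_deriv \<alpha> r s \<beta> (1 / 2 * trace_form r u) (d s u) ((3 * \<beta>) *\<^sub>C u) 0 =
    6 * (3 * \<alpha> * \<beta> - 1 / 2 * trace_form r s) * (- D s s u)
     + (trace_form r u * D s s s + 18 * \<alpha> * \<beta> * D s s u + 6 * \<beta> * C r r (d s u))
     - (2 * C r (d s u) (d s s) + 6 * \<beta> * D s u (c r r))"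
    using rs u by (simp add: quartic_deriv_def tr D.trilinear mem 2 algebra_simps)
  also have "\<dots> = 0" unfolding 1 3 by (simp add: algebra_simps)
  finally show ?thesis by simp
qed

lemma quartic_deriv_zorn_act:
  assumes X: "X \<in> annihilators" and t: "t \<in> W" and u: "u \<in> W" and w: "w \<in> Z2 A"
  shows "((\<lambda>e. quartic A C D (w + e *\<^sub>R zorn_act A C D X k t u w)) has_vector_derivative 0) (at 0)"
proof -
  obtain \<alpha> r s \<beta> where w': "w = (\<alpha>, r, s, \<beta>)" by (metis surj_pair)
  have rs: "r \<in> W" "s \<in> W" using w by (simp_all add: w' Z2_iff)
  note lin = annihilator_linear[OF X]
  have m: "X r \<in> W" "dual_lie_act A X s \<in> W"
    using rs dual_lie_mem[OF A lin] clinear_on_mem[OF lin] by auto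
  have "quartic_deriv \<alpha> r s \<beta>
     (0 + - (3 / 2) * k * \<alpha> + 0 + 1 / 2 * trace_form r u)
     (X r + (- (1 / 2) * k) *\<^sub>C r + (3 * \<alpha>) *\<^sub>C t + d s u)
     (dual_lie_act A X s + (1 / 2 * k) *\<^sub>C s + c r t + (3 * \<beta>) *\<^sub>C u)
     (0 + 3 / 2 * k * \<beta> + 1 / 2 * trace_form t s + 0) = 0"
    using rs t u m quartic_deriv_annihilator[OF X rs] quartic_deriv_scalar[OF rs]
      quartic_deriv_W[OF rs t] quartic_deriv_dual[OF rs u]
    by (subst quartic_deriv_add, simp_all only: mem)+ simp
  moreover have "zorn_act A C D X k t u w =
     (0 + - (3 / 2) * k * \<alpha> + 0 + 1 / 2 * trace_form r u,
      X r + (- (1 / 2) * k) *\<^sub>C r + (3 * \<alpha>) *\<^sub>C t + d s u,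
      dual_lie_act A X s + (1 / 2 * k) *\<^sub>C s + c r t + (3 * \<beta>) *\<^sub>C u,
      0 + 3 / 2 * k * \<beta> + 1 / 2 * trace_form t s + 0)"
    by (simp add: w' zorn_act_eq)
  moreover have "X r + (- (1 / 2) * k) *\<^sub>C r + (3 * \<alpha>) *\<^sub>C t + d s u \<in> W"
    "dual_lie_act A X s + (1 / 2 * k) *\<^sub>C s + c r t + (3 * \<beta>) *\<^sub>C u \<in> W"
    using rs t u m by (simp_all only: mem)
  ultimately show ?thesis
    using quartic_line_derivative[OF rs] unfolding w' by metis
qed

lemma quartic_polynomial: "polynomial_on (Z2 A) (quartic A C D)"
proof -
  have p: "polynomial_on (Z2 A) fst" "polynomial_on (Z2 A) (\<lambda>w. snd (snd (snd w)))"
    "polynomial_map A (Z2 A) (\<lambda>w. fst (snd w))" "polynomial_map A (Z2 A) (\<lambda>w. fst (snd (snd w)))"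
    by (auto intro!: poly_linear polynomial_map_linear clinear_onI simp: scaleC_prod_def Z2_def)
  note Z = subspace_Z2
  have "polynomial_on (Z2 A) (\<lambda>w. (3 * fst w * snd (snd (snd w))
       - 1 / 2 * trace_form (fst (snd w)) (fst (snd (snd w))))\<^sup>2
     + 1 / 3 * (snd (snd (snd w)) * C (fst (snd w)) (fst (snd w)) (fst (snd w))
       + fst w * D (fst (snd (snd w))) (fst (snd (snd w))) (fst (snd (snd w))))
     - 1 / 6 * trace_form (d (fst (snd (snd w))) (fst (snd (snd w)))) (c (fst (snd w)) (fst (snd w))))"
    by (intro polynomial_on_diff poly_add poly_mult poly_const polynomial_on_power p
        polynomial_map_pairing[OF A Z] C.polynomial_on_cubic[OF Z] D.polynomial_on_cubic[OF Z]
        C.polynomial_map_contract[OF Z] D.polynomial_map_contract[OF Z])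
  then show ?thesis
    by (rule polynomial_on_cong[OF Z]) (simp add: quartic_def split: prod.splits)
qed

lemma quartic_invariant: "invariant_on (Z2 A) (Sp6 A C D) (quartic A C D)"
proof -
  have step: "quartic A C D (op_exp Y w) = quartic A C D w" "op_exp Y w \<in> Z2 A"
    if Y: "Y \<in> sp6 A C D" and w: "w \<in> Z2 A" for Y w
  proof -
    obtain X k t u where Y': "Y = zorn_act A C D X k t u" "X \<in> annihilators" "t \<in> W" "u \<in> W"
      using Y unfolding sp6_def lie_algebra_SL3 by blast
    note lin = zorn_act_linear[OF Y'(2-4), of k]
    show "quartic A C D (op_exp Y w) = quartic A C D w" "op_exp Y w \<in> Z2 A"
      using polynomial_on_flow_invariant[OF subspace_Z2 quartic_polynomial lin
          quartic_deriv_zorn_act[OF Y'(2-4)] w, of 1] op_exp_mem[OF subspace_Z2 lin w, of 1]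
      by (simp_all add: Y'(1))
  qed
  have "quartic A C D (g w) = quartic A C D w \<and> g w \<in> Z2 A"
    if "g \<in> generated_group (sp6 A C D)" "w \<in> Z2 A" for g w
    using that by induction (simp_all add: step)
  then show ?thesis by (simp add: invariant_on_def Sp6_def)
qed

lemma quartic_restriction:
  "quartic A C D (\<alpha>, x *\<^sub>C I, y *\<^sub>C I, \<beta>) =
     (3 * \<alpha> * \<beta> - 3 / 2 * (x * y))\<^sup>2 + 1 / 3 * (\<beta> * (a * x^3) + \<alpha> * (b * y^3)) - 3 * (x * y)\<^sup>2"
proof -
  have "trace_form (x *\<^sub>C I) (y *\<^sub>C I) = 3 * (x * y)"
    by (simp add: tr mem trace_form_omat_one)
  moreover have "C (x *\<^sub>C I) (x *\<^sub>C I) (x *\<^sub>C I) = a * x^3"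
    "D (y *\<^sub>C I) (y *\<^sub>C I) (y *\<^sub>C I) = b * y^3"
    by (simp_all add: C.trilinear D.trilinear mem C_one D_one power3_eq_cube)
  moreover have "trace_form (d (y *\<^sub>C I) (y *\<^sub>C I)) (c (x *\<^sub>C I) (x *\<^sub>C I)) = 18 * (x * y)\<^sup>2"
  proof -
    have "trace_form (d (y *\<^sub>C I) (y *\<^sub>C I)) (c (x *\<^sub>C I) (x *\<^sub>C I)) = (a * b) / 3 * (x * y)\<^sup>2"
      by (simp add: C.contract_scaleC D.contract_scaleC mem c_one d_one scaleC_scaleC tr
          trace_form_omat_one power2_eq_square)
    then show ?thesis by (simp add: ab)
  qed
  ultimately show ?thesis by (simp add: quartic_def)
qed

text \<open>Comparison of coefficients forces \<open>k = 1/3\<close>, \<open>l m = 3/2\<close>, \<open>l\<^sup>3 = a/4\<close> and \<open>m\<^sup>3 = b/4\<close>, which is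
  consistent because \<open>a b = 54\<close>.\<close>

lemma quartic_restricts_to_disc:
  obtains l m k where "l \<noteq> 0" "m \<noteq> 0" "k \<noteq> 0" "restricts_to_disc l m k (quartic A C D)"
proof -
  define l where "l = exp (Ln (a / 4) / of_nat 3)"
  define m where "m = 3 / (2 * l)"
  have l: "l \<noteq> 0" by (simp add: l_def)
  have l3: "l^3 = a / 4"
    unfolding l_def using nonzero by (subst exp_divide_power_eq) simp_all
  have lm: "l * m = 3 / 2" using l by (simp add: m_def)
  have "m^3 = 27 / (8 * l^3)" by (simp add: m_def power_divide power_mult_distrib)
  also have "\<dots> = b / 4" using ab nonzero by (simp add: l3 field_simps)
  finally have m3: "m^3 = b / 4" .
  have "quartic A C D (\<alpha>, x *\<^sub>C I, y *\<^sub>C I, \<beta>) = 1 / 3 * cubic_disc \<alpha> (l * x) (m * y) \<beta>" for \<alpha> x y \<beta>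
  proof -
    have xy: "l * x * (m * y) = 3 / 2 * (x * y)" using lm by algebra
    have sq: "4 * (l * x)\<^sup>2 * (m * y)\<^sup>2 = 4 * (3 / 2 * (x * y))\<^sup>2"
      unfolding xy[symmetric] by (simp add: power_mult_distrib)
    have cubes: "(l * x)^3 = a / 4 * x^3" "(m * y)^3 = b / 4 * y^3"
      by (simp_all add: power_mult_distrib l3 m3)
    show ?thesis
      unfolding quartic_restriction cubic_disc_def xy sq cubes
      by (simp add: power2_eq_square field_simps)
  qed
  then have "restricts_to_disc l m (1 / 3) (quartic A C D)"
    by (simp add: restricts_to_disc_def)
  then show ?thesis using l lm by (intro that[of l m "1 / 3"]) auto
qed

section \<open>Invariants are determined on the diagonal\<close>

lemma contract_zero: "r \<in> W \<Longrightarrow> c r 0 = 0" "r \<in> W \<Longrightarrow> d r 0 = 0"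
  using C.contract_scaleC(2)[of r 0 0] D.contract_scaleC(2)[of r 0 0] by (simp_all add: mem)

lemma zorn_act_annihilator:
  "r \<in> W \<Longrightarrow> s \<in> W \<Longrightarrow> zorn_act A C D X 0 0 0 (\<alpha>, r, s, \<beta>) = (0, X r, dual_lie_act A X s, 0)"
  by (simp add: zorn_act_eq contract_zero trace_form_zero[OF _ A] tr_commute[of 0])

lemma dual_lie_scaleR:
  assumes X: "clinear_on W W X" and s: "s \<in> W"
  shows "dual_lie_act A (\<lambda>v. k *\<^sub>R X v) s = k *\<^sub>R dual_lie_act A X s"
proof -
  have kX: "clinear_on W W (\<lambda>v. k *\<^sub>R X v)"
    using clinear_on_mem[OF X] clinear_on_add[OF X] clinear_on_scaleC[OF X]
    by (intro clinear_onI) (simp_all add: mem scaleR_add_right scaleR_scaleC)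
  show ?thesis
  proof (rule trace_form_nondegenerate[OF A dual_lie_mem[OF A kX s]])
    show "k *\<^sub>R dual_lie_act A X s \<in> W" using dual_lie_mem[OF A X s] by (simp add: mem)
    fix t assume t: "t \<in> W"
    show "trace_form t (dual_lie_act A (\<lambda>v. k *\<^sub>R X v) s) = trace_form t (k *\<^sub>R dual_lie_act A X s)"
      unfolding trace_form_dual_lie[OF A kX s t] using t s
      by (simp add: scaleR_eq_scaleC tr dual_lie_mem[OF A X] trace_form_dual_lie[OF A X]
          clinear_on_mem[OF X])
  qed
qed

lemma op_exp_in_Sp6:
  assumes "X \<in> annihilators" "t \<in> W" "u \<in> W"
  shows "op_exp (zorn_act A C D X k t u) \<in> Sp6 A C D"
proof -
  have "zorn_act A C D X k t u \<in> sp6 A C D"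
    unfolding sp6_def lie_algebra_SL3 using assms by blast
  from gen_exp[OF this gen_id] show ?thesis by (simp add: Sp6_def)
qed

lemma invariant_on_annihilator_flow:
  assumes inv: "invariant_on (Z2 A) (Sp6 A C D) F" and X: "X \<in> annihilators" and w: "w \<in> Z2 A"
  shows "F (op_exp (\<lambda>v. k *\<^sub>R zorn_act A C D X 0 0 0 v) w) = F w"
proof -
  have "op_exp (\<lambda>v. k *\<^sub>R zorn_act A C D X 0 0 0 v) w = op_exp (zorn_act A C D (\<lambda>v. k *\<^sub>R X v) 0 0 0) w"
  proof (rule op_exp_cong[OF _ _ w])
    fix v assume v: "v \<in> Z2 A"
    then show "k *\<^sub>R zorn_act A C D X 0 0 0 v = zorn_act A C D (\<lambda>v. k *\<^sub>R X v) 0 0 0 v"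
      by (cases v) (simp add: Z2_iff zorn_act_annihilator dual_lie_scaleR[OF annihilator_linear[OF X]])
    show "k *\<^sub>R zorn_act A C D X 0 0 0 v \<in> Z2 A"
      using csubspace_scaleR[OF subspace_Z2] clinear_on_mem[OF zorn_act_linear[OF X]] v by (simp add: mem)
  qed
  then show ?thesis
    using inv op_exp_in_Sp6[OF scaleR_annihilator[OF X]] w by (simp add: invariant_on_def mem)
qed

text \<open>On the slice \<open>r = 0\<close> only the Lie algebra of the group of the determinant is used. Let \<open>\<sigma>\<close> run
  from \<open>I\<close> to \<open>s\<close> on a straight line. Divided by a cube root of its normalized cubic, it becomes a
  curve \<open>\<gamma>\<close> in a level set of \<open>D\<close>, defined as long as that cubic stays in the right half-plane.
  The velocity of \<open>\<gamma>\<close> is tangent to the level set and hence produced by an annihilator, so that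
  \<open>F\<close> is constant along every multiple of \<open>\<gamma>\<close>. The factor can be chosen such that the end point is
  \<open>\<sigma>\<close> again; therefore \<open>F\<close> vanishes on a segment of the line, and then at \<open>s\<close>.\<close>

lemma invariant_zero_on_slice:
  assumes poly: "polynomial_on (Z2 A) F" and inv: "invariant_on (Z2 A) (Sp6 A C D) F"
    and zero: "\<And>\<alpha> x y \<beta>. F (\<alpha>, x *\<^sub>C I, y *\<^sub>C I, \<beta>) = 0" and s: "s \<in> W"
  shows "F (\<alpha>, 0, s, \<beta>) = 0"
proof -
  define v where "v = s - I"
  have v: "v \<in> W" using s by (simp add: v_def mem)
  define \<sigma> where "\<sigma> z = I + z *\<^sub>C v" for z
  have \<sigma>: "\<sigma> z \<in> W" for z using v by (simp add: \<sigma>_def mem)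
  define n where "n z = D (\<sigma> z) (\<sigma> z) (\<sigma> z) / b" for z
  obtain q where q: "\<And>z. D (\<sigma> z) (\<sigma> z) (\<sigma> z) = poly q z"
    using polynomial_on_line[OF subspace_W D.polynomial_on_cube J3_omat_one[OF A] v]
    unfolding \<sigma>_def by metis
  have n0: "n 0 = 1" by (simp add: n_def \<sigma>_def D_one nonzero)
  have n_deriv: "(n has_field_derivative poly (pderiv q) z / b) (at z)" for z
    unfolding n_def q by (rule DERIV_cdivide[OF poly_DERIV])
  have "isCont (\<lambda>\<tau>. n (complex_of_real \<tau>)) 0"
    by (rule isCont_o2[where f = complex_of_real and g = n]) (auto intro: DERIV_isCont[OF n_deriv])
  then have "isCont (\<lambda>\<tau>. Re (n (complex_of_real \<tau>))) 0"
    by (rule isCont_Re)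
  then have "eventually (\<lambda>\<tau>. Re (n (complex_of_real \<tau>)) > 0) (at 0)"
    unfolding isCont_def by (rule order_tendstoD) (simp add: n0)
  then obtain \<delta> where \<delta>: "\<delta> > 0" and pos': "\<And>\<tau>. \<tau> \<noteq> 0 \<Longrightarrow> \<bar>\<tau>\<bar> < \<delta> \<Longrightarrow> Re (n (complex_of_real \<tau>)) > 0"
    unfolding eventually_at by (auto simp: dist_real_def)
  have pos: "Re (n (complex_of_real \<tau>)) > 0" if "\<bar>\<tau>\<bar> < \<delta>" for \<tau>
    using pos'[OF _ that] n0 by (cases "\<tau> = 0") auto
  \<comment> \<open>A branch of \<open>n\<close> to the power \<open>-1/3\<close>.\<close>
  define \<rho> where "\<rho> \<tau> = exp (- Ln (n (complex_of_real \<tau>)) / 3)" for \<tau>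
  have \<rho>3: "\<rho> \<tau> ^ 3 * n (complex_of_real \<tau>) = 1" if "\<bar>\<tau>\<bar> < \<delta>" for \<tau>
  proof -
    have "n (complex_of_real \<tau>) \<noteq> 0" using pos[OF that] by auto
    moreover have "\<rho> \<tau> ^ 3 = exp (- Ln (n (complex_of_real \<tau>)))"
      unfolding \<rho>_def by (subst exp_divide_power_eq[of 3, simplified]) simp_all
    ultimately show ?thesis by (simp add: exp_minus)
  qed
  have \<rho>_deriv: "\<exists>\<rho>'. (\<rho> has_vector_derivative \<rho>') (at \<tau>)" if "\<bar>\<tau>\<bar> < \<delta>" for \<tau>
  proof -
    have "n (complex_of_real \<tau>) \<notin> \<real>\<^sub>\<le>\<^sub>0"
      using pos[OF that] by (auto simp: complex_nonpos_Reals_iff)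
    from DERIV_chain2[OF DERIV_exp DERIV_cdivide[OF
        DERIV_minus[OF DERIV_chain2[OF has_field_derivative_Ln[OF this] n_deriv]], of 3]]
    have "\<exists>D. ((\<lambda>z. exp (- Ln (n z) / 3)) has_field_derivative D) (at (complex_of_real \<tau>))"
      by (rule exI)
    then show ?thesis
      unfolding \<rho>_def using has_vector_derivative_real_field by blast
  qed
  define \<gamma> where "\<gamma> \<tau> = \<rho> \<tau> *\<^sub>C \<sigma> (complex_of_real \<tau>)" for \<tau>
  have \<gamma>: "\<gamma> \<tau> \<in> W" for \<tau> using \<sigma> by (simp add: \<gamma>_def mem)
  have \<gamma>0: "\<gamma> 0 = I" by (simp add: \<gamma>_def \<rho>_def \<sigma>_def n0)
  have \<gamma>_deriv: "\<exists>\<gamma>'\<in>W. (\<gamma> has_vector_derivative \<gamma>') (at \<tau>)" if \<tau>: "\<bar>\<tau>\<bar> < \<delta>" for \<tau>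
  proof -
    obtain \<rho>' where \<rho>': "(\<rho> has_vector_derivative \<rho>') (at \<tau>)" using \<rho>_deriv[OF \<tau>] by blast
    have bl: "bounded_linear (\<lambda>z. z *\<^sub>C x)" for x :: omat
    proof -
      have "linear (\<lambda>z. z *\<^sub>C x)"
        by (intro linearI) (simp_all add: scaleC_add_left scaleR_eq_scaleC scaleC_scaleC scaleC_complex_def)
      then show ?thesis using linear_conv_bounded_linear by blast
    qed
    have "((\<lambda>\<tau>. \<rho> \<tau> * complex_of_real \<tau>) has_vector_derivative \<rho> \<tau> + \<rho>' * complex_of_real \<tau>) (at \<tau>)"
      using has_vector_derivative_mult[OF \<rho>' has_vector_derivative_of_real[OF DERIV_ident]] by simp
    from has_vector_derivative_add[OF bounded_linear.has_vector_derivative[OF bl \<rho>', of I]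
        bounded_linear.has_vector_derivative[OF bl this, of v]]
    have "(\<gamma> has_vector_derivative \<rho>' *\<^sub>C I + (\<rho> \<tau> + \<rho>' * complex_of_real \<tau>) *\<^sub>C v) (at \<tau>)"
      by (simp add: \<gamma>_def[abs_def] \<sigma>_def scaleC_add_right scaleC_scaleC)
    moreover have "\<rho>' *\<^sub>C I + (\<rho> \<tau> + \<rho>' * complex_of_real \<tau>) *\<^sub>C v \<in> W" using v by (simp add: mem)
    ultimately show ?thesis by blast
  qed
  have cube: "D (\<gamma> \<tau>) (\<gamma> \<tau>) (\<gamma> \<tau>) = b" if "\<bar>\<tau>\<bar> < \<delta>" for \<tau>
  proof -
    have "D (\<gamma> \<tau>) (\<gamma> \<tau>) (\<gamma> \<tau>) = (\<rho> \<tau> ^ 3 * n (complex_of_real \<tau>)) * b"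
      using \<sigma> nonzero by (simp add: \<gamma>_def D.trilinear mem n_def power3_eq_cube)
    then show ?thesis by (simp add: \<rho>3[OF that])
  qed
  \<comment> \<open>Constancy along \<open>y *\<^sub>C \<gamma>\<close>, which starts at the multiple \<open>y *\<^sub>C I\<close> of the identity.\<close>
  have path: "F (\<alpha>, 0, y *\<^sub>C \<gamma> \<tau>, \<beta>) = 0" if \<tau>: "\<bar>\<tau>\<bar> < \<delta>" for y \<tau>
  proof -
    let ?P = "\<lambda>\<tau>. (\<alpha>, 0::omat, y *\<^sub>C \<gamma> \<tau>, \<beta>)"
    have P: "?P \<tau> \<in> Z2 A" for \<tau> using \<gamma> by (simp add: Z2_iff mem)
    have "((\<lambda>\<tau>. F (?P \<tau>)) has_vector_derivative 0) (at \<tau>)" if \<tau>: "\<bar>\<tau>\<bar> < \<delta>" for \<tau>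
    proof -
      obtain \<gamma>' where \<gamma>': "\<gamma>' \<in> W" "(\<gamma> has_vector_derivative \<gamma>') (at \<tau>)"
        using \<gamma>_deriv[OF \<tau>] by blast
      have "((\<lambda>\<tau>. D (\<gamma> \<tau>) (\<gamma> \<tau>) (\<gamma> \<tau>)) has_vector_derivative 3 * D (\<gamma> \<tau>) (\<gamma> \<tau>) \<gamma>') (at \<tau>)"
        using polynomial_on_derivative_by_line[OF subspace_W D.polynomial_on_cube _ \<gamma>'(2,1)
            D.cube_derivative_on_line[OF \<gamma> \<gamma>'(1)]] \<gamma> by auto
      moreover have "((\<lambda>\<tau>. D (\<gamma> \<tau>) (\<gamma> \<tau>) (\<gamma> \<tau>)) has_vector_derivative 0) (at \<tau>)"
        by (rule has_vector_derivative_transform_within_open[of "\<lambda>_. b" _ _ "{-\<delta><..<\<delta>}"])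
          (use \<tau> cube in auto)
      ultimately have "3 * D (\<gamma> \<tau>) (\<gamma> \<tau>) \<gamma>' = 0" by (rule vector_derivative_unique_at)
      then obtain X where X: "X \<in> annihilators" "dual_lie_act A X (\<gamma> \<tau>) = \<gamma>'"
        using annihilators_transitive[OF \<gamma>, of \<tau> \<gamma>'] cube[OF \<tau>] \<gamma>'(1) nonzero by auto
      have lin: "linear (\<lambda>x::omat. (0::complex, 0::omat, y *\<^sub>C x, 0::complex))"
        by (intro linearI) (simp_all add: scaleC_add_right scaleR_scaleC)
      then have "bounded_linear (\<lambda>x::omat. (0::complex, 0::omat, y *\<^sub>C x, 0::complex))"
        using linear_conv_bounded_linear by blast
      from has_vector_derivative_add[OF has_vector_derivative_const[of "(\<alpha>, 0, 0, \<beta>)"]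
          bounded_linear.has_vector_derivative[OF this \<gamma>'(2)]]
      have "(?P has_vector_derivative (0, 0, y *\<^sub>C \<gamma>', 0)) (at \<tau>)"
        by (simp add: zero_prod_def)
      moreover have "zorn_act A C D X 0 0 0 (?P \<tau>) = (0, 0, y *\<^sub>C \<gamma>', 0)"
        using \<gamma> clinear_on_scaleC[OF dual_lie_clinear[OF A annihilator_linear[OF X(1)]] \<gamma>] X(2)
          clinear_on_zero[OF annihilator_linear[OF X(1)] subspace_W]
        by (simp add: zorn_act_annihilator mem)
      ultimately have "(?P has_vector_derivative zorn_act A C D X 0 0 0 (?P \<tau>)) (at \<tau>)"
        by simp
      then show ?thesis
        using P by (intro polynomial_on_infinitesimal_invariant[OF subspace_Z2 poly
            zorn_act_linear[OF X(1)] invariant_on_annihilator_flow[OF inv X(1) P[of \<tau>]] P[of \<tau>]])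
          (auto simp: mem)
    qed
    then have "F (?P \<tau>) = F (?P 0)"
      using \<tau> \<delta> by (intro has_derivative_zero_unique[of "{-\<delta><..<\<delta>}" "\<lambda>\<tau>. F (?P \<tau>)"])
        (auto simp: has_vector_derivative_def intro: has_derivative_at_withinI)
    then show ?thesis using zero[of \<alpha> 0 y \<beta>] by (simp add: \<gamma>0)
  qed
  show ?thesis
  proof (rule polynomial_on_eq_zero_by_line[OF subspace_Z2 poly])
    show "(\<alpha>, 0, I, \<beta>) \<in> Z2 A" "(\<alpha>, 0, s, \<beta>) \<in> Z2 A" using s by (simp_all add: Z2_iff mem)
    have "F ((\<alpha>, 0, I, \<beta>) + complex_of_real \<tau> *\<^sub>C ((\<alpha>, 0, s, \<beta>) - (\<alpha>, 0, I, \<beta>))) = 0"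
      if "\<tau> \<in> {0<..<\<delta>}" for \<tau>
    proof -
      have "\<rho> \<tau> \<noteq> 0" by (simp add: \<rho>_def)
      then have "(1 / \<rho> \<tau>) *\<^sub>C \<gamma> \<tau> = I + complex_of_real \<tau> *\<^sub>C (s - I)"
        by (simp add: \<gamma>_def scaleC_scaleC \<sigma>_def v_def)
      then show ?thesis
        using path[of \<tau> "1 / \<rho> \<tau>"] that by (simp add: scaleC_prod_def scaleC_complex_def)
    qed
    then have "complex_of_real ` {0<..<\<delta>} \<subseteq>
        {z. F ((\<alpha>, 0, I, \<beta>) + z *\<^sub>C ((\<alpha>, 0, s, \<beta>) - (\<alpha>, 0, I, \<beta>))) = 0}" by auto
    moreover have "infinite (complex_of_real ` {0<..<\<delta>})"
      using \<delta> by (simp add: finite_image_iff inj_on_def infinite_Ioo)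
    ultimately show "infinite {z. F ((\<alpha>, 0, I, \<beta>) + z *\<^sub>C ((\<alpha>, 0, s, \<beta>) - (\<alpha>, 0, I, \<beta>))) = 0}"
      using finite_subset by blast
  qed
qed

text \<open>For \<open>\<alpha> \<noteq> 0\<close> the exponential of \<open>t = - r / (3 \<alpha>)\<close> moves \<open>(\<alpha>, r, s, \<beta>)\<close> into the slice
  \<open>r = 0\<close>: along its flow the first entry is constant and the second one is affine with velocity
  \<open>3 \<alpha> t = - r\<close>.\<close>

lemma invariant_zero:
  assumes poly: "polynomial_on (Z2 A) F" and inv: "invariant_on (Z2 A) (Sp6 A C D) F"
    and zero: "\<And>\<alpha> x y \<beta>. F (\<alpha>, x *\<^sub>C I, y *\<^sub>C I, \<beta>) = 0" and w: "w \<in> Z2 A"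
  shows "F w = 0"
proof (rule polynomial_on_integral_domain[OF subspace_Z2 poly, of fst "(1, 0, 0, 0)"])
  show "polynomial_on (Z2 A) fst"
    by (intro poly_linear clinear_onI) (auto simp: scaleC_prod_def)
  fix w assume w: "w \<in> Z2 A" and nz: "fst w \<noteq> 0"
  obtain \<alpha> r s \<beta> where w': "w = (\<alpha>, r, s, \<beta>)" by (metis surj_pair)
  have rs: "r \<in> W" "s \<in> W" and \<alpha>: "\<alpha> \<noteq> 0" using w nz by (simp_all add: w' Z2_iff)
  define t where "t = (- 1 / (3 * \<alpha>)) *\<^sub>C r"
  have t: "t \<in> W" using rs by (simp add: t_def mem)
  define Y where "Y = zorn_act A C D (\<lambda>_. 0) 0 t 0"
  have lin: "clinear_on (Z2 A) (Z2 A) Y"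
    unfolding Y_def by (rule zorn_act_linear[OF zero_annihilator t]) (simp add: mem)
  define E where "E k = op_exp (\<lambda>v. k *\<^sub>R Y v) w" for k
  have E_mem: "E k \<in> Z2 A" for k unfolding E_def by (rule op_exp_mem[OF subspace_Z2 lin w])
  have E_deriv: "(E has_vector_derivative Y (E k)) (at k)" for k
    unfolding E_def by (rule op_exp_flow[OF subspace_Z2 lin w])
  have E0: "E 0 = w" by (simp add: E_def op_exp_zero)
  have Y: "fst (Y x) = 0" "fst (snd (Y x)) = (3 * fst x) *\<^sub>C t" if "x \<in> Z2 A" for x
    using that by (cases x; simp add: Y_def zorn_act_eq Z2_iff contract_zero trace_form_zero[OF _ A])+
  have fstE: "fst (E k) = \<alpha>" for k
  proof -
    have "((\<lambda>k. fst (E k)) has_vector_derivative 0) (at k)" for k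
      using bounded_linear.has_vector_derivative[OF bounded_linear_fst E_deriv[of k]] Y E_mem by simp
    then have "fst (E k) = fst (E 0)"
      by (intro has_derivative_zero_unique[of UNIV]) (auto simp: has_vector_derivative_def)
    then show ?thesis by (simp add: E0 w')
  qed
  have "fst (snd (E k)) + k *\<^sub>R r = r" for k
  proof -
    have "(3 * \<alpha>) *\<^sub>C t = - r"
      using \<alpha> by (simp add: t_def scaleC_scaleC scaleC_minus_one)
    then have "((\<lambda>k. fst (snd (E k))) has_vector_derivative - r) (at k)" for k
      using bounded_linear.has_vector_derivative[OF bounded_linear_fst
          bounded_linear.has_vector_derivative[OF bounded_linear_snd E_deriv[of k]]] Y(2)[OF E_mem] fstE by simp
    then have "((\<lambda>k. fst (snd (E k)) + k *\<^sub>R r) has_vector_derivative 0) (at k)" for k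
      by (auto intro!: derivative_eq_intros)
    then have "fst (snd (E k)) + k *\<^sub>R r = fst (snd (E 0)) + 0 *\<^sub>R r"
      by (intro has_derivative_zero_unique[of UNIV "\<lambda>k. fst (snd (E k)) + k *\<^sub>R r"])
        (auto simp: has_vector_derivative_def)
    then show ?thesis by (simp add: E0 w')
  qed
  from this[of 1] have "E 1 = (\<alpha>, 0, fst (snd (snd (E 1))), snd (snd (snd (E 1))))"
    using fstE[of 1] by (simp add: prod_eq_iff)
  moreover have "fst (snd (snd (E 1))) \<in> W" using E_mem[of 1] by (simp add: Z2_def mem_Times_iff)
  ultimately have "F (E 1) = 0"
    using invariant_zero_on_slice[OF poly inv zero] by metis
  moreover have "F (E 1) = F w"
    using inv op_exp_in_Sp6[OF zero_annihilator t, of 0 0] w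
    by (simp add: E_def Y_def invariant_on_def mem)
  ultimately show "F w = 0" by simp
qed (use w in \<open>auto simp: Z2_iff mem\<close>)

end

theorem proposition5p7:
  fixes A :: "oct set" and C D :: trilinear
  assumes "A \<in> {alg_R, alg_C, alg_H, alg_O}"
    and "det_multiple A C"
    and "dual_invariant_cubic A D"
    and "normalized A C D"
  shows "\<exists>l m k. l \<noteq> 0 \<and> m \<noteq> 0 \<and> k \<noteq> 0 \<and>
      polynomial_on (Z2 A) (quartic A C D) \<and>
      invariant_on (Z2 A) (Sp6 A C D) (quartic A C D) \<and>
      restricts_to_disc l m k (quartic A C D) \<and>
      (\<forall>P. polynomial_on (Z2 A) P \<and> invariant_on (Z2 A) (Sp6 A C D) P \<and> restricts_to_disc l m k P
         \<longrightarrow> (\<forall>w\<in>Z2 A. P w = quartic A C D w))"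
proof -
  have A: "cnj_subalgebra A" by (rule cnj_subalgebra_algs[OF assms(1)])
  obtain a where a: "a \<noteq> 0"
    and C: "\<And>r s t. r \<in> J3 A \<Longrightarrow> s \<in> J3 A \<Longrightarrow> t \<in> J3 A \<Longrightarrow> C r s t = a * jdet_polar r s t"
    using assms(2) unfolding det_multiple_def by blast
  have D: "symmetric_trilinear_on (J3 A) D"
    using assms(3) by (simp add: dual_invariant_cubic_def)
  interpret normalized_dets A C D a "54 / a"
    using A C normalized_dual_det[OF A C a D assms(4)] a assms(4) by unfold_locales auto
  obtain l m k where lmk: "l \<noteq> 0" "m \<noteq> 0" "k \<noteq> 0" "restricts_to_disc l m k (quartic A C D)"
    using quartic_restricts_to_disc .
  have "P w = quartic A C D w"
    if P: "polynomial_on (Z2 A) P" "invariant_on (Z2 A) (Sp6 A C D) P" "restricts_to_disc l m k P"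
      and w: "w \<in> Z2 A" for P w
  proof -
    have "P w - quartic A C D w = 0"
    proof (rule invariant_zero[OF _ _ _ w])
      show "polynomial_on (Z2 A) (\<lambda>w. P w - quartic A C D w)"
        by (rule polynomial_on_diff[OF P(1) quartic_polynomial])
      show "invariant_on (Z2 A) (Sp6 A C D) (\<lambda>w. P w - quartic A C D w)"
        using P(2) quartic_invariant by (simp add: invariant_on_def)
      show "P (\<alpha>, x *\<^sub>C omat_one, y *\<^sub>C omat_one, \<beta>)
          - quartic A C D (\<alpha>, x *\<^sub>C omat_one, y *\<^sub>C omat_one, \<beta>) = 0" for \<alpha> x y \<beta>
        using P(3) lmk(4) by (simp add: restricts_to_disc_def)
    qed
    then show ?thesis by simp
  qed
  then show ?thesis
    using lmk quartic_polynomial quartic_invariant by blast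
qed

end
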